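(* Let $C$ be a spherical fusion category with Drinfeld center $\mathcal{Z}(C)$. For every $q\in\mathrm{Gal}(K_C)$ there exists $q'\in\mathrm{Gal}(K_{\mathcal{Z}(C)})$ such that $$\mathcal{Z}(q(C))=q'(\mathcal{Z}(C)),$$ and vice versa: for every $q'\in\mathrm{Gal}(K_{\mathcal{Z}(C)})$ there exists $q\in\mathrm{Gal}(K_C)$ such that this equality holds.
   Context: A spherical fusion category $C$ is described, after choosing bases of the fusion spaces $V_{ab}^c=\mathrm{Hom}(a\otimes b,c)$ (such a choice is called a gauge), by its $F$ symbols (associativity matrices) together with pivotal/spherical coefficients $\epsilon_a\in\{\pm1\}$; a modular tensor category (MTC) has in addition $R$ symbols (braiding matrices). Gauges are chosen so that all these entries lie in a number field. For a spherical fusion category $C$, $K_C$ is the Galois (normal) closure of $\mathbb{Q}(F)$, the field generated by the $F$ symbols of $C$. For the MTC $\mathcal{Z}(C)$, $K_{\mathcal{Z}(C)}$ is the Galois closure of the field generated over $\mathbb{Q}$ by the $F$ and $R$ symbols of $\mathcal{Z}(C)$. All Galois groups are over $\mathbb{Q}$. For $q\in\mathrm{Gal}(K_C)$, $q(C)$ is the spherical fusion category with the same simple objects and fusion rules and with $F$ symbols $q(F)$; for $q'\in\mathrm{Gal}(K_{\mathcal{Z}(C)})$, $q'(\mathcal{Z}(C))$ is the MTC with the same simple objects and fusion rules and with data $q'(F),q'(R)$. Equality of MTCs means equivalence of modular tensor categories. *)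

theory Defs
  imports
    Complex_Main
    "HOL-Library.FuncSet"
    "HOL-Computational_Algebra.Polynomial_Factorial"
begin

section \<open>Subfields of the complex numbers and their Galois groups\<close>

definition complex_subfield :: "complex set \<Rightarrow> bool" where
  "complex_subfield K \<longleftrightarrow> 0 \<in> K \<and> 1 \<in> K \<and>
     (\<forall>x\<in>K. \<forall>y\<in>K. x + y \<in> K \<and> x * y \<in> K) \<and> (\<forall>x\<in>K. - x \<in> K \<and> inverse x \<in> K)"

definition rat_adjoin :: "complex set \<Rightarrow> complex set" where
  "rat_adjoin A = \<Inter>{K. complex_subfield K \<and> A \<subseteq> K}"

definition number_field :: "complex set \<Rightarrow> bool" where
  "number_field K \<longleftrightarrow> complex_subfield K \<and>
     (\<exists>B. finite B \<and> B \<subseteq> K \<and> (\<forall>x\<in>K. \<exists>r::complex \<Rightarrow> rat. x = (\<Sum>b\<in>B. of_rat (r b) * b)))"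

text \<open>An irreducible rational polynomial with one root in \<open>K\<close> has all its roots in \<open>K\<close>.\<close>

definition normal_over_rat :: "complex set \<Rightarrow> bool" where
  "normal_over_rat K \<longleftrightarrow> complex_subfield K \<and>
     (\<forall>p::rat poly. irreducible p \<longrightarrow> (\<exists>z\<in>K. poly (map_poly of_rat p) z = 0) \<longrightarrow>
        (\<forall>z::complex. poly (map_poly of_rat p) z = 0 \<longrightarrow> z \<in> K))"

definition galois_closure :: "complex set \<Rightarrow> complex set" where
  "galois_closure K = \<Inter>{N. normal_over_rat N \<and> K \<subseteq> N}"

definition galois_group :: "complex set \<Rightarrow> (complex \<Rightarrow> complex) set" where
  "galois_group K = {q \<in> extensional K. bij_betw q K K \<and>
     (\<forall>x\<in>K. \<forall>y\<in>K. q (x + y) = q x + q y \<and> q (x * y) = q x * q y) \<and>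
     (\<forall>r. q (of_rat r) = of_rat r)}"


section \<open>Complex-linear monoidal categories\<close>

text \<open>
  Hom sets belonging to different pairs of objects are allowed to overlap.
  The associator goes from \<open>(X \<otimes> Y) \<otimes> Z\<close> to \<open>X \<otimes> (Y \<otimes> Z)\<close>, the unitors from
  \<open>\<one> \<otimes> X\<close> and \<open>X \<otimes> \<one>\<close> to \<open>X\<close>.
\<close>

record ('o, 'm) moncat =
  obj :: "'o set"
  hom :: "'o \<Rightarrow> 'o \<Rightarrow> 'm set"
  ide :: "'o \<Rightarrow> 'm"
  cmp :: "'m \<Rightarrow> 'm \<Rightarrow> 'm"  (infixr "\<cdot>\<index>" 70)
  zer :: "'o \<Rightarrow> 'o \<Rightarrow> 'm"
  add :: "'m \<Rightarrow> 'm \<Rightarrow> 'm"  (infixl "\<oplus>\<index>" 65)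
  scl :: "complex \<Rightarrow> 'm \<Rightarrow> 'm"  (infixr "\<odot>\<index>" 75)
  tenO :: "'o \<Rightarrow> 'o \<Rightarrow> 'o"  (infixr "\<otimes>\<index>" 80)
  tenM :: "'m \<Rightarrow> 'm \<Rightarrow> 'm"  (infixr "\<boxtimes>\<index>" 80)
  unit :: 'o  ("\<one>\<index>")
  asc :: "'o \<Rightarrow> 'o \<Rightarrow> 'o \<Rightarrow> 'm"
  lun :: "'o \<Rightarrow> 'm"
  run :: "'o \<Rightarrow> 'm"

text \<open>
  Pivotal structure in two-sided form: the object \<open>dl X\<close> is a left dual of \<open>X\<close> through
  \<open>ev X : dl X \<otimes> X \<rightarrow> \<one>\<close>, \<open>coev X : \<one> \<rightarrow> X \<otimes> dl X\<close>, and a right dual through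
  \<open>evr X : X \<otimes> dl X \<rightarrow> \<one>\<close>, \<open>coevr X : \<one> \<rightarrow> dl X \<otimes> X\<close>.
\<close>

record ('o, 'm) pivcat = "('o, 'm) moncat" +
  dl :: "'o \<Rightarrow> 'o"
  ev :: "'o \<Rightarrow> 'm"
  coev :: "'o \<Rightarrow> 'm"
  evr :: "'o \<Rightarrow> 'm"
  coevr :: "'o \<Rightarrow> 'm"

record ('o, 'm) ribcat = "('o, 'm) moncat" +
  braid :: "'o \<Rightarrow> 'o \<Rightarrow> 'm"
  twist :: "'o \<Rightarrow> 'm"

context
  fixes C :: "('o, 'm, 'x) moncat_scheme" (structure)
begin

definition inverse_pair :: "'o \<Rightarrow> 'o \<Rightarrow> 'm \<Rightarrow> 'm \<Rightarrow> bool" where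
  "inverse_pair X Y f g \<longleftrightarrow> f \<in> hom C X Y \<and> g \<in> hom C Y X \<and> g \<cdot> f = ide C X \<and> f \<cdot> g = ide C Y"

definition iso :: "'o \<Rightarrow> 'o \<Rightarrow> 'm \<Rightarrow> bool" where
  "iso X Y f \<longleftrightarrow> (\<exists>g. inverse_pair X Y f g)"

definition minv :: "'o \<Rightarrow> 'o \<Rightarrow> 'm \<Rightarrow> 'm" where
  "minv X Y f = (THE g. inverse_pair X Y f g)"

definition ascinv :: "'o \<Rightarrow> 'o \<Rightarrow> 'o \<Rightarrow> 'm" where
  "ascinv X Y Z = minv ((X \<otimes> Y) \<otimes> Z) (X \<otimes> (Y \<otimes> Z)) (asc C X Y Z)"

definition zero_object :: "'o \<Rightarrow> bool" where
  "zero_object X \<longleftrightarrow> X \<in> obj C \<and> ide C X = zer C X X"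

definition simple_object :: "'o \<Rightarrow> bool" where
  "simple_object X \<longleftrightarrow> X \<in> obj C \<and> ide C X \<noteq> zer C X X \<and> hom C X X = {z \<odot> ide C X | z. True}"

definition biproduct :: "'o \<Rightarrow> 'o \<Rightarrow> 'o \<Rightarrow> bool" where
  "biproduct X A B \<longleftrightarrow> X \<in> obj C \<and> A \<in> obj C \<and> B \<in> obj C \<and>
     (\<exists>p\<in>hom C X A. \<exists>p'\<in>hom C X B. \<exists>i\<in>hom C A X. \<exists>i'\<in>hom C B X.
        p \<cdot> i = ide C A \<and> p' \<cdot> i' = ide C B \<and> p \<cdot> i' = zer C B A \<and> p' \<cdot> i = zer C A B \<and>
        (i \<cdot> p) \<oplus> (i' \<cdot> p') = ide C X)"

inductive finite_sum_of :: "'o set \<Rightarrow> 'o \<Rightarrow> bool" for I where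
  "zero_object X \<Longrightarrow> finite_sum_of I X"
| "A \<in> I \<Longrightarrow> finite_sum_of I B \<Longrightarrow> biproduct X A B \<Longrightarrow> finite_sum_of I X"

text \<open>\<open>I\<close> is a finite system of representatives of the simple objects, and the category is
  semisimple.\<close>

definition simple_representatives :: "'o set \<Rightarrow> bool" where
  "simple_representatives I \<longleftrightarrow> finite I \<and> (\<forall>i\<in>I. simple_object i) \<and>
     (\<forall>i\<in>I. \<forall>j\<in>I. i \<noteq> j \<longrightarrow> hom C i j = {zer C i j}) \<and> (\<forall>X\<in>obj C. finite_sum_of I X)"

text \<open>\<open>L\<close> is a left dual of \<open>X\<close>.\<close>

definition dual_pair :: "'o \<Rightarrow> 'o \<Rightarrow> 'm \<Rightarrow> 'm \<Rightarrow> bool" where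
  "dual_pair L X e k \<longleftrightarrow> L \<in> obj C \<and> X \<in> obj C \<and> e \<in> hom C (L \<otimes> X) \<one> \<and> k \<in> hom C \<one> (X \<otimes> L) \<and>
     run C X \<cdot> (ide C X \<boxtimes> e) \<cdot> asc C X L X \<cdot> (k \<boxtimes> ide C X) = lun C X \<and>
     lun C L \<cdot> (e \<boxtimes> ide C L) \<cdot> ascinv L X L \<cdot> (ide C L \<boxtimes> k) = run C L"

text \<open>Given pairings \<open>e : A \<otimes> X \<rightarrow> \<one>\<close> and \<open>e' : B \<otimes> Y \<rightarrow> \<one>\<close>, the nested pairing
  \<open>(B \<otimes> A) \<otimes> (X \<otimes> Y) \<rightarrow> \<one>\<close>.\<close>

definition nested_pairing :: "'o \<Rightarrow> 'o \<Rightarrow> 'o \<Rightarrow> 'o \<Rightarrow> 'm \<Rightarrow> 'm \<Rightarrow> 'm" where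
  "nested_pairing B A X Y e e' =
     e' \<cdot> (ide C B \<boxtimes> lun C Y) \<cdot> (ide C B \<boxtimes> (e \<boxtimes> ide C Y)) \<cdot> (ide C B \<boxtimes> ascinv A X Y) \<cdot>
     asc C B A (X \<otimes> Y)"

end

locale linear_category =
  fixes C :: "('o, 'm, 'x) moncat_scheme" (structure)
  assumes ide_hom: "X \<in> obj C \<Longrightarrow> ide C X \<in> hom C X X"
    and cmp_hom: "\<lbrakk>X \<in> obj C; Y \<in> obj C; Z \<in> obj C; f \<in> hom C X Y; g \<in> hom C Y Z\<rbrakk>
          \<Longrightarrow> g \<cdot> f \<in> hom C X Z"
    and cmp_assoc: "\<lbrakk>W \<in> obj C; X \<in> obj C; Y \<in> obj C; Z \<in> obj C;
          f \<in> hom C W X; g \<in> hom C X Y; h \<in> hom C Y Z\<rbrakk> \<Longrightarrow> (h \<cdot> g) \<cdot> f = h \<cdot> (g \<cdot> f)"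
    and cmp_ide: "\<lbrakk>X \<in> obj C; Y \<in> obj C; f \<in> hom C X Y\<rbrakk>
          \<Longrightarrow> ide C Y \<cdot> f = f \<and> f \<cdot> ide C X = f"
    and zer_hom: "\<lbrakk>X \<in> obj C; Y \<in> obj C\<rbrakk> \<Longrightarrow> zer C X Y \<in> hom C X Y"
    and add_hom: "\<lbrakk>X \<in> obj C; Y \<in> obj C; f \<in> hom C X Y; g \<in> hom C X Y\<rbrakk> \<Longrightarrow> f \<oplus> g \<in> hom C X Y"
    and scl_hom: "\<lbrakk>X \<in> obj C; Y \<in> obj C; f \<in> hom C X Y\<rbrakk> \<Longrightarrow> z \<odot> f \<in> hom C X Y"
    and add_assoc: "\<lbrakk>X \<in> obj C; Y \<in> obj C; f \<in> hom C X Y; g \<in> hom C X Y; h \<in> hom C X Y\<rbrakk>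
          \<Longrightarrow> (f \<oplus> g) \<oplus> h = f \<oplus> (g \<oplus> h)"
    and add_commute: "\<lbrakk>X \<in> obj C; Y \<in> obj C; f \<in> hom C X Y; g \<in> hom C X Y\<rbrakk> \<Longrightarrow> f \<oplus> g = g \<oplus> f"
    and add_zer: "\<lbrakk>X \<in> obj C; Y \<in> obj C; f \<in> hom C X Y\<rbrakk> \<Longrightarrow> f \<oplus> zer C X Y = f"
    and add_neg: "\<lbrakk>X \<in> obj C; Y \<in> obj C; f \<in> hom C X Y\<rbrakk> \<Longrightarrow> f \<oplus> ((-1) \<odot> f) = zer C X Y"
    and scl_one: "\<lbrakk>X \<in> obj C; Y \<in> obj C; f \<in> hom C X Y\<rbrakk> \<Longrightarrow> 1 \<odot> f = f"
    and scl_scl: "\<lbrakk>X \<in> obj C; Y \<in> obj C; f \<in> hom C X Y\<rbrakk> \<Longrightarrow> z \<odot> (w \<odot> f) = (z * w) \<odot> f"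
    and scl_add: "\<lbrakk>X \<in> obj C; Y \<in> obj C; f \<in> hom C X Y; g \<in> hom C X Y\<rbrakk>
          \<Longrightarrow> z \<odot> (f \<oplus> g) = (z \<odot> f) \<oplus> (z \<odot> g)"
    and add_scl: "\<lbrakk>X \<in> obj C; Y \<in> obj C; f \<in> hom C X Y\<rbrakk>
          \<Longrightarrow> (z + w) \<odot> f = (z \<odot> f) \<oplus> (w \<odot> f)"
    and cmp_add: "\<lbrakk>X \<in> obj C; Y \<in> obj C; Z \<in> obj C; f \<in> hom C X Y; f' \<in> hom C X Y;
          g \<in> hom C Y Z; g' \<in> hom C Y Z\<rbrakk>
          \<Longrightarrow> g \<cdot> (f \<oplus> f') = (g \<cdot> f) \<oplus> (g \<cdot> f') \<and> (g \<oplus> g') \<cdot> f = (g \<cdot> f) \<oplus> (g' \<cdot> f)"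
    and cmp_scl: "\<lbrakk>X \<in> obj C; Y \<in> obj C; Z \<in> obj C; f \<in> hom C X Y; g \<in> hom C Y Z\<rbrakk>
          \<Longrightarrow> g \<cdot> (z \<odot> f) = z \<odot> (g \<cdot> f) \<and> (z \<odot> g) \<cdot> f = z \<odot> (g \<cdot> f)"

locale linear_monoidal_category = linear_category +
  assumes unit_obj: "\<one> \<in> obj C"
    and tenO_obj: "\<lbrakk>X \<in> obj C; Y \<in> obj C\<rbrakk> \<Longrightarrow> X \<otimes> Y \<in> obj C"
    and tenM_hom: "\<lbrakk>X \<in> obj C; X' \<in> obj C; Y \<in> obj C; Y' \<in> obj C; f \<in> hom C X X'; g \<in> hom C Y Y'\<rbrakk>
          \<Longrightarrow> f \<boxtimes> g \<in> hom C (X \<otimes> Y) (X' \<otimes> Y')"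
    and tenM_ide: "\<lbrakk>X \<in> obj C; Y \<in> obj C\<rbrakk> \<Longrightarrow> ide C X \<boxtimes> ide C Y = ide C (X \<otimes> Y)"
    and tenM_cmp: "\<lbrakk>X \<in> obj C; X' \<in> obj C; X'' \<in> obj C; Y \<in> obj C; Y' \<in> obj C; Y'' \<in> obj C;
          f \<in> hom C X X'; f' \<in> hom C X' X''; g \<in> hom C Y Y'; g' \<in> hom C Y' Y''\<rbrakk>
          \<Longrightarrow> (f' \<cdot> f) \<boxtimes> (g' \<cdot> g) = (f' \<boxtimes> g') \<cdot> (f \<boxtimes> g)"
    and tenM_add: "\<lbrakk>X \<in> obj C; X' \<in> obj C; Y \<in> obj C; Y' \<in> obj C;
          f \<in> hom C X X'; f' \<in> hom C X X'; g \<in> hom C Y Y'; g' \<in> hom C Y Y'\<rbrakk>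
          \<Longrightarrow> (f \<oplus> f') \<boxtimes> g = (f \<boxtimes> g) \<oplus> (f' \<boxtimes> g) \<and> f \<boxtimes> (g \<oplus> g') = (f \<boxtimes> g) \<oplus> (f \<boxtimes> g')"
    and tenM_scl: "\<lbrakk>X \<in> obj C; X' \<in> obj C; Y \<in> obj C; Y' \<in> obj C; f \<in> hom C X X'; g \<in> hom C Y Y'\<rbrakk>
          \<Longrightarrow> (z \<odot> f) \<boxtimes> g = z \<odot> (f \<boxtimes> g) \<and> f \<boxtimes> (z \<odot> g) = z \<odot> (f \<boxtimes> g)"
    and asc_iso: "\<lbrakk>X \<in> obj C; Y \<in> obj C; Z \<in> obj C\<rbrakk>
          \<Longrightarrow> iso C ((X \<otimes> Y) \<otimes> Z) (X \<otimes> (Y \<otimes> Z)) (asc C X Y Z)"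
    and lun_iso: "X \<in> obj C \<Longrightarrow> iso C (\<one> \<otimes> X) X (lun C X)"
    and run_iso: "X \<in> obj C \<Longrightarrow> iso C (X \<otimes> \<one>) X (run C X)"
    and asc_natural: "\<lbrakk>X \<in> obj C; X' \<in> obj C; Y \<in> obj C; Y' \<in> obj C; Z \<in> obj C; Z' \<in> obj C;
          f \<in> hom C X X'; g \<in> hom C Y Y'; h \<in> hom C Z Z'\<rbrakk>
          \<Longrightarrow> asc C X' Y' Z' \<cdot> ((f \<boxtimes> g) \<boxtimes> h) = (f \<boxtimes> (g \<boxtimes> h)) \<cdot> asc C X Y Z"
    and lun_natural: "\<lbrakk>X \<in> obj C; Y \<in> obj C; f \<in> hom C X Y\<rbrakk>
          \<Longrightarrow> lun C Y \<cdot> (ide C \<one> \<boxtimes> f) = f \<cdot> lun C X"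
    and run_natural: "\<lbrakk>X \<in> obj C; Y \<in> obj C; f \<in> hom C X Y\<rbrakk>
          \<Longrightarrow> run C Y \<cdot> (f \<boxtimes> ide C \<one>) = f \<cdot> run C X"
    and pentagon: "\<lbrakk>W \<in> obj C; X \<in> obj C; Y \<in> obj C; Z \<in> obj C\<rbrakk>
          \<Longrightarrow> (ide C W \<boxtimes> asc C X Y Z) \<cdot> asc C W (X \<otimes> Y) Z \<cdot> (asc C W X Y \<boxtimes> ide C Z) =
              asc C W X (Y \<otimes> Z) \<cdot> asc C (W \<otimes> X) Y Z"
    and triangle: "\<lbrakk>X \<in> obj C; Y \<in> obj C\<rbrakk>
          \<Longrightarrow> (ide C X \<boxtimes> lun C Y) \<cdot> asc C X \<one> Y = run C X \<boxtimes> ide C Y"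

locale fusion_category = linear_monoidal_category +
  assumes ex_zero_object: "\<exists>X. zero_object C X"
    and ex_biproduct: "\<lbrakk>A \<in> obj C; B \<in> obj C\<rbrakk> \<Longrightarrow> \<exists>X. biproduct C X A B"
    and ex_simple_representatives: "\<exists>I. simple_representatives C I"
    and unit_simple: "simple_object C \<one>"
    and ex_left_dual: "X \<in> obj C \<Longrightarrow> \<exists>L e k. dual_pair C L X e k"
    and ex_right_dual: "X \<in> obj C \<Longrightarrow> \<exists>R e k. dual_pair C X R e k"

text \<open>
  The assumptions \<open>dual_mor\<close>, \<open>dual_tensor\<close> and \<open>dual_unit\<close> say that the left and the right
  duality functors defined by the chosen duals coincide as monoidal functors, i.e. that
  the induced isomorphism from \<open>X\<close> to its double dual is natural and monoidal.
\<close>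

locale spherical_fusion_category =
  fusion_category C for C :: "('o, 'm, 'x) pivcat_scheme" (structure) +
  assumes left_dual: "X \<in> obj C \<Longrightarrow> dual_pair C (dl C X) X (ev C X) (coev C X)"
    and right_dual: "X \<in> obj C \<Longrightarrow> dual_pair C X (dl C X) (evr C X) (coevr C X)"
    and dual_mor: "\<lbrakk>X \<in> obj C; Y \<in> obj C; f \<in> hom C X Y\<rbrakk> \<Longrightarrow> \<exists>g\<in>hom C (dl C Y) (dl C X).
          ev C X \<cdot> (g \<boxtimes> ide C X) = ev C Y \<cdot> (ide C (dl C Y) \<boxtimes> f) \<and>
          evr C X \<cdot> (ide C X \<boxtimes> g) = evr C Y \<cdot> (f \<boxtimes> ide C (dl C Y))"
    and dual_tensor: "\<lbrakk>X \<in> obj C; Y \<in> obj C\<rbrakk> \<Longrightarrow> \<exists>j\<in>hom C (dl C Y \<otimes> dl C X) (dl C (X \<otimes> Y)).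
          ev C (X \<otimes> Y) \<cdot> (j \<boxtimes> ide C (X \<otimes> Y)) =
            nested_pairing C (dl C Y) (dl C X) X Y (ev C X) (ev C Y) \<and>
          evr C (X \<otimes> Y) \<cdot> (ide C (X \<otimes> Y) \<boxtimes> j) =
            nested_pairing C X Y (dl C Y) (dl C X) (evr C Y) (evr C X)"
    and dual_unit: "\<exists>u\<in>hom C \<one> (dl C \<one>).
          ev C \<one> \<cdot> (u \<boxtimes> ide C \<one>) = lun C \<one> \<and> evr C \<one> \<cdot> (ide C \<one> \<boxtimes> u) = run C \<one>"
    and spherical: "\<lbrakk>X \<in> obj C; f \<in> hom C X X\<rbrakk> \<Longrightarrow>
          ev C X \<cdot> (ide C (dl C X) \<boxtimes> f) \<cdot> coevr C X = evr C X \<cdot> (f \<boxtimes> ide C (dl C X)) \<cdot> coev C X"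


section \<open>Modular tensor categories and their equivalence\<close>

text \<open>The quantum trace of a ribbon category (it does not depend on the dual that is used).\<close>

definition quantum_trace :: "('o, 'm, 'x) ribcat_scheme \<Rightarrow> 'o \<Rightarrow> 'm \<Rightarrow> complex \<Rightarrow> bool" where
  "quantum_trace C X f z \<longleftrightarrow> (\<exists>L e k. dual_pair C L X e k \<and>
     e \<cdot>\<^bsub>C\<^esub> braid C X L \<cdot>\<^bsub>C\<^esub> ((twist C X \<cdot>\<^bsub>C\<^esub> f) \<boxtimes>\<^bsub>C\<^esub> ide C L) \<cdot>\<^bsub>C\<^esub> k = z \<odot>\<^bsub>C\<^esub> ide C \<one>\<^bsub>C\<^esub>)"

locale modular_tensor_category =
  fusion_category C for C :: "('o, 'm, 'x) ribcat_scheme" (structure) +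
  assumes braid_iso: "\<lbrakk>X \<in> obj C; Y \<in> obj C\<rbrakk> \<Longrightarrow> iso C (X \<otimes> Y) (Y \<otimes> X) (braid C X Y)"
    and braid_natural: "\<lbrakk>X \<in> obj C; X' \<in> obj C; Y \<in> obj C; Y' \<in> obj C; f \<in> hom C X X'; g \<in> hom C Y Y'\<rbrakk>
          \<Longrightarrow> braid C X' Y' \<cdot> (f \<boxtimes> g) = (g \<boxtimes> f) \<cdot> braid C X Y"
    and hexagon1: "\<lbrakk>X \<in> obj C; Y \<in> obj C; Z \<in> obj C\<rbrakk> \<Longrightarrow>
          asc C Y Z X \<cdot> braid C X (Y \<otimes> Z) \<cdot> asc C X Y Z =
          (ide C Y \<boxtimes> braid C X Z) \<cdot> asc C Y X Z \<cdot> (braid C X Y \<boxtimes> ide C Z)"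
    and hexagon2: "\<lbrakk>X \<in> obj C; Y \<in> obj C; Z \<in> obj C\<rbrakk> \<Longrightarrow>
          ascinv C Z X Y \<cdot> braid C (X \<otimes> Y) Z \<cdot> ascinv C X Y Z =
          (braid C X Z \<boxtimes> ide C Y) \<cdot> ascinv C X Z Y \<cdot> (ide C X \<boxtimes> braid C Y Z)"
    and twist_iso: "X \<in> obj C \<Longrightarrow> iso C X X (twist C X)"
    and twist_natural: "\<lbrakk>X \<in> obj C; Y \<in> obj C; f \<in> hom C X Y\<rbrakk>
          \<Longrightarrow> twist C Y \<cdot> f = f \<cdot> twist C X"
    and twist_tensor: "\<lbrakk>X \<in> obj C; Y \<in> obj C\<rbrakk> \<Longrightarrow>
          twist C (X \<otimes> Y) = braid C Y X \<cdot> braid C X Y \<cdot> (twist C X \<boxtimes> twist C Y)"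
    and twist_dual: "dual_pair C L X e k \<Longrightarrow>
          e \<cdot> (twist C L \<boxtimes> ide C X) = e \<cdot> (ide C L \<boxtimes> twist C X)"
    and S_matrix_invertible: "\<exists>I s t. simple_representatives C I \<and>
          (\<forall>i\<in>I. \<forall>j\<in>I. quantum_trace C (i \<otimes> j) (braid C j i \<cdot> braid C i j) (s i j)) \<and>
          (\<forall>i\<in>I. \<forall>k\<in>I. (\<Sum>j\<in>I. s i j * t j k) = (if i = k then 1 else (0::complex)))"

text \<open>
  A ribbon equivalence from \<open>A\<close> to \<open>B\<close>: a complex-linear, fully faithful, essentially
  surjective functor \<open>(Fo, Fm)\<close> with monoidal structure \<open>J X Y : Fo X \<otimes> Fo Y \<rightarrow> Fo (X \<otimes> Y)\<close>,
  \<open>u : \<one> \<rightarrow> Fo \<one>\<close>, compatible with braidings and twists.  The action on morphisms depends on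
  source and target since hom sets may overlap.
\<close>

locale ribbon_equivalence =
  fixes A :: "('o, 'm, 'x) ribcat_scheme" and B :: "('p, 'n, 'y) ribcat_scheme"
    and Fo :: "'o \<Rightarrow> 'p" and Fm :: "'o \<Rightarrow> 'o \<Rightarrow> 'm \<Rightarrow> 'n" and J :: "'o \<Rightarrow> 'o \<Rightarrow> 'n" and u :: 'n
  assumes Fo_obj: "X \<in> obj A \<Longrightarrow> Fo X \<in> obj B"
    and fully_faithful: "\<lbrakk>X \<in> obj A; Y \<in> obj A\<rbrakk>
          \<Longrightarrow> bij_betw (Fm X Y) (hom A X Y) (hom B (Fo X) (Fo Y))"
    and ess_surj: "P \<in> obj B \<Longrightarrow> \<exists>X\<in>obj A. \<exists>f. iso B (Fo X) P f"
    and Fm_ide: "X \<in> obj A \<Longrightarrow> Fm X X (ide A X) = ide B (Fo X)"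
    and Fm_cmp: "\<lbrakk>X \<in> obj A; Y \<in> obj A; Z \<in> obj A; f \<in> hom A X Y; g \<in> hom A Y Z\<rbrakk>
          \<Longrightarrow> Fm X Z (g \<cdot>\<^bsub>A\<^esub> f) = Fm Y Z g \<cdot>\<^bsub>B\<^esub> Fm X Y f"
    and Fm_add: "\<lbrakk>X \<in> obj A; Y \<in> obj A; f \<in> hom A X Y; g \<in> hom A X Y\<rbrakk>
          \<Longrightarrow> Fm X Y (f \<oplus>\<^bsub>A\<^esub> g) = Fm X Y f \<oplus>\<^bsub>B\<^esub> Fm X Y g"
    and Fm_scl: "\<lbrakk>X \<in> obj A; Y \<in> obj A; f \<in> hom A X Y\<rbrakk>
          \<Longrightarrow> Fm X Y (z \<odot>\<^bsub>A\<^esub> f) = z \<odot>\<^bsub>B\<^esub> Fm X Y f"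
    and J_iso: "\<lbrakk>X \<in> obj A; Y \<in> obj A\<rbrakk>
          \<Longrightarrow> iso B (Fo X \<otimes>\<^bsub>B\<^esub> Fo Y) (Fo (X \<otimes>\<^bsub>A\<^esub> Y)) (J X Y)"
    and u_iso: "iso B \<one>\<^bsub>B\<^esub> (Fo \<one>\<^bsub>A\<^esub>) u"
    and J_natural: "\<lbrakk>X \<in> obj A; X' \<in> obj A; Y \<in> obj A; Y' \<in> obj A; f \<in> hom A X X'; g \<in> hom A Y Y'\<rbrakk>
          \<Longrightarrow> Fm (X \<otimes>\<^bsub>A\<^esub> Y) (X' \<otimes>\<^bsub>A\<^esub> Y') (f \<boxtimes>\<^bsub>A\<^esub> g) \<cdot>\<^bsub>B\<^esub> J X Y =
              J X' Y' \<cdot>\<^bsub>B\<^esub> (Fm X X' f \<boxtimes>\<^bsub>B\<^esub> Fm Y Y' g)"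
    and J_asc: "\<lbrakk>X \<in> obj A; Y \<in> obj A; Z \<in> obj A\<rbrakk> \<Longrightarrow>
          Fm ((X \<otimes>\<^bsub>A\<^esub> Y) \<otimes>\<^bsub>A\<^esub> Z) (X \<otimes>\<^bsub>A\<^esub> (Y \<otimes>\<^bsub>A\<^esub> Z)) (asc A X Y Z) \<cdot>\<^bsub>B\<^esub>
            J (X \<otimes>\<^bsub>A\<^esub> Y) Z \<cdot>\<^bsub>B\<^esub> (J X Y \<boxtimes>\<^bsub>B\<^esub> ide B (Fo Z)) =
          J X (Y \<otimes>\<^bsub>A\<^esub> Z) \<cdot>\<^bsub>B\<^esub> (ide B (Fo X) \<boxtimes>\<^bsub>B\<^esub> J Y Z) \<cdot>\<^bsub>B\<^esub> asc B (Fo X) (Fo Y) (Fo Z)"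
    and J_lun: "X \<in> obj A \<Longrightarrow>
          Fm (\<one>\<^bsub>A\<^esub> \<otimes>\<^bsub>A\<^esub> X) X (lun A X) \<cdot>\<^bsub>B\<^esub> J \<one>\<^bsub>A\<^esub> X \<cdot>\<^bsub>B\<^esub> (u \<boxtimes>\<^bsub>B\<^esub> ide B (Fo X)) = lun B (Fo X)"
    and J_run: "X \<in> obj A \<Longrightarrow>
          Fm (X \<otimes>\<^bsub>A\<^esub> \<one>\<^bsub>A\<^esub>) X (run A X) \<cdot>\<^bsub>B\<^esub> J X \<one>\<^bsub>A\<^esub> \<cdot>\<^bsub>B\<^esub> (ide B (Fo X) \<boxtimes>\<^bsub>B\<^esub> u) = run B (Fo X)"
    and Fm_braid: "\<lbrakk>X \<in> obj A; Y \<in> obj A\<rbrakk> \<Longrightarrow>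
          Fm (X \<otimes>\<^bsub>A\<^esub> Y) (Y \<otimes>\<^bsub>A\<^esub> X) (braid A X Y) \<cdot>\<^bsub>B\<^esub> J X Y = J Y X \<cdot>\<^bsub>B\<^esub> braid B (Fo X) (Fo Y)"
    and Fm_twist: "X \<in> obj A \<Longrightarrow> Fm X X (twist A X) = twist B (Fo X)"

definition mtc_equivalent ::
  "('o, 'm, 'x) ribcat_scheme \<Rightarrow> ('p, 'n, 'y) ribcat_scheme \<Rightarrow> bool" where
  "mtc_equivalent A B \<longleftrightarrow> (\<exists>Fo Fm J u. ribbon_equivalence A B Fo Fm J u)"


section \<open>The Drinfeld center\<close>

context
  fixes C :: "('o, 'm, 'x) pivcat_scheme" (structure)
begin

text \<open>For \<open>b = c\<^bsub>X,X\<^esub> : X \<otimes> X \<rightarrow> X \<otimes> X\<close> a (half-)braiding, the right partial trace of \<open>b\<close>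
  is the twist of \<open>X\<close>.\<close>

definition right_partial_trace :: "'o \<Rightarrow> 'm \<Rightarrow> 'm" where
  "right_partial_trace X b =
     run C X \<cdot> (ide C X \<boxtimes> evr C X) \<cdot> asc C X X (dl C X) \<cdot> (b \<boxtimes> ide C (dl C X)) \<cdot>
     ascinv C X X (dl C X) \<cdot> (ide C X \<boxtimes> coev C X) \<cdot> minv C (X \<otimes> \<one>) X (run C X)"

text \<open>Half-braidings \<open>\<beta> W : X \<otimes> W \<rightarrow> W \<otimes> X\<close>; compatibility with \<open>\<one>\<close> follows from the hexagon.\<close>

definition half_braiding :: "'o \<Rightarrow> ('o \<Rightarrow> 'm) \<Rightarrow> bool" where
  "half_braiding X \<beta> \<longleftrightarrow> \<beta> \<in> extensional (obj C) \<and>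
     (\<forall>W\<in>obj C. iso C (X \<otimes> W) (W \<otimes> X) (\<beta> W)) \<and>
     (\<forall>W\<in>obj C. \<forall>V\<in>obj C. \<forall>f\<in>hom C W V. \<beta> V \<cdot> (ide C X \<boxtimes> f) = (f \<boxtimes> ide C X) \<cdot> \<beta> W) \<and>
     (\<forall>W\<in>obj C. \<forall>V\<in>obj C. asc C W V X \<cdot> \<beta> (W \<otimes> V) \<cdot> asc C X W V =
        (ide C W \<boxtimes> \<beta> V) \<cdot> asc C W X V \<cdot> (\<beta> W \<boxtimes> ide C V))"

definition drinfeld_center :: "('o \<times> ('o \<Rightarrow> 'm), 'm) ribcat" where
  "drinfeld_center =
     \<lparr> obj = {(X, \<beta>). X \<in> obj C \<and> half_braiding X \<beta>},
       hom = (\<lambda>(X, \<beta>) (Y, \<gamma>). {f \<in> hom C X Y.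
                \<forall>W\<in>obj C. (ide C W \<boxtimes> f) \<cdot> \<beta> W = \<gamma> W \<cdot> (f \<boxtimes> ide C W)}),
       ide = (\<lambda>(X, \<beta>). ide C X),
       cmp = cmp C,
       zer = (\<lambda>(X, \<beta>) (Y, \<gamma>). zer C X Y),
       add = add C,
       scl = scl C,
       tenO = (\<lambda>(X, \<beta>) (Y, \<gamma>). (X \<otimes> Y, \<lambda>W\<in>obj C.
                asc C W X Y \<cdot> (\<beta> W \<boxtimes> ide C Y) \<cdot> ascinv C X W Y \<cdot> (ide C X \<boxtimes> \<gamma> W) \<cdot> asc C X Y W)),
       tenM = tenM C,
       unit = (\<one>, \<lambda>W\<in>obj C. minv C (W \<otimes> \<one>) W (run C W) \<cdot> lun C W),
       asc = (\<lambda>(X, \<beta>) (Y, \<gamma>) (Z, \<delta>). asc C X Y Z),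
       lun = (\<lambda>(X, \<beta>). lun C X),
       run = (\<lambda>(X, \<beta>). run C X),
       braid = (\<lambda>(X, \<beta>) (Y, \<gamma>). \<beta> Y),
       twist = (\<lambda>(X, \<beta>). right_partial_trace X (\<beta> X)) \<rparr>"

end


section \<open>F symbols, R symbols and the categories they describe\<close>

text \<open>
  \<open>Nrk a b c\<close> is the dimension of \<open>V\<^bsub>ab\<^esub>\<^bsup>c\<^esup> = Hom(a \<otimes> b, c)\<close>, whose chosen basis is indexed by
  \<open>0, \<dots>, Nrk a b c - 1\<close>.  \<open>Fsym a b c d (e, \<alpha>, \<beta>) (f, \<mu>, \<nu>)\<close> is the matrix entry of the associator
  \<open>(a \<otimes> b) \<otimes> c \<rightarrow> a \<otimes> (b \<otimes> c)\<close> from the copy of \<open>d\<close> in \<open>(a \<otimes> b) \<otimes> c\<close> labelled by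
  \<open>\<alpha> \<in> V\<^bsub>ab\<^esub>\<^bsup>e\<^esup>, \<beta> \<in> V\<^bsub>ec\<^esub>\<^bsup>d\<^esup>\<close> to the copy of \<open>d\<close> in \<open>a \<otimes> (b \<otimes> c)\<close> labelled by
  \<open>\<mu> \<in> V\<^bsub>bc\<^esub>\<^bsup>f\<^esup>, \<nu> \<in> V\<^bsub>af\<^esub>\<^bsup>d\<^esup>\<close>; \<open>Rsym a b c \<mu> \<nu>\<close> is the entry of the braiding \<open>a \<otimes> b \<rightarrow> b \<otimes> a\<close>
  from the copy of \<open>c\<close> labelled by \<open>\<mu> \<in> V\<^bsub>ab\<^esub>\<^bsup>c\<^esup>\<close> to the one labelled by \<open>\<nu> \<in> V\<^bsub>ba\<^esub>\<^bsup>c\<^esup>\<close>.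
  The bases of \<open>V\<^bsub>1a\<^esub>\<^bsup>a\<^esup>\<close> and \<open>V\<^bsub>a1\<^esub>\<^bsup>a\<^esup>\<close> are the unitors.
\<close>

record 'a fusion_data =
  labels :: "'a set"
  unit_label :: 'a
  dual_label :: "'a \<Rightarrow> 'a"
  Nrk :: "'a \<Rightarrow> 'a \<Rightarrow> 'a \<Rightarrow> nat"
  Fsym :: "'a \<Rightarrow> 'a \<Rightarrow> 'a \<Rightarrow> 'a \<Rightarrow> 'a \<times> nat \<times> nat \<Rightarrow> 'a \<times> nat \<times> nat \<Rightarrow> complex"
  eps :: "'a \<Rightarrow> complex"

record 'a modular_data = "'a fusion_data" +
  Rsym :: "'a \<Rightarrow> 'a \<Rightarrow> 'a \<Rightarrow> nat \<Rightarrow> nat \<Rightarrow> complex"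

text \<open>
  An object of the category described by the data is a finite set of indices; an index \<open>t\<close> stands
  for one copy of the simple object \<open>rlabel t\<close>, and the set for the direct sum of these copies.
  \<open>Leaf a n\<close> is a plain copy of \<open>a\<close>, \<open>Dua t\<close> the dual of the copy \<open>t\<close>, and \<open>Node s t c \<mu>\<close> the copy
  of \<open>c\<close> in the tensor product of \<open>s\<close> and \<open>t\<close> that belongs to the \<open>\<mu>\<close>th basis vector of
  \<open>V\<^bsub>ab\<^esub>\<^bsup>c\<^esup>\<close>, \<open>a = rlabel s\<close>, \<open>b = rlabel t\<close>.  Morphisms are label preserving matrices, indexed by
  (row, column) = (target, source).
\<close>

datatype 'a idx = Leaf 'a nat | Dua "'a idx" | Node "'a idx" "'a idx" 'a nat

type_synonym 'a mat = "'a idx \<Rightarrow> 'a idx \<Rightarrow> complex"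

context
  fixes S :: "('a, 'x) fusion_data_scheme"
begin

primrec rlabel :: "'a idx \<Rightarrow> 'a" where
  "rlabel (Leaf a n) = a"
| "rlabel (Dua t) = dual_label S (rlabel t)"
| "rlabel (Node s t c \<mu>) = c"

definition skel_hom :: "'a idx set \<Rightarrow> 'a idx set \<Rightarrow> 'a mat set" where
  "skel_hom X Y = {f. \<forall>t s. f t s \<noteq> 0 \<longrightarrow> t \<in> Y \<and> s \<in> X \<and> rlabel t = rlabel s}"

definition skel_cmp :: "'a mat \<Rightarrow> 'a mat \<Rightarrow> 'a mat" where
  "skel_cmp g f = (\<lambda>t s. \<Sum>m | f m s \<noteq> 0. g t m * f m s)"

definition skel_unit :: "'a idx set" where
  "skel_unit = {Leaf (unit_label S) 0}"

definition skel_tenO :: "'a idx set \<Rightarrow> 'a idx set \<Rightarrow> 'a idx set" where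
  "skel_tenO X Y =
     {Node s t c \<mu> | s t c \<mu>. s \<in> X \<and> t \<in> Y \<and> c \<in> labels S \<and> \<mu> < Nrk S (rlabel s) (rlabel t) c}"

definition skel_tenM :: "'a mat \<Rightarrow> 'a mat \<Rightarrow> 'a mat" where
  "skel_tenM f g = (\<lambda>t s. case (t, s) of
     (Node t1 t2 c \<mu>, Node s1 s2 d \<nu>) \<Rightarrow>
       if c = d \<and> \<mu> = \<nu> \<and> c \<in> labels S \<and> \<mu> < Nrk S (rlabel s1) (rlabel s2) c
       then f t1 s1 * g t2 s2 else 0
   | _ \<Rightarrow> 0)"

definition skel_asc :: "'a idx set \<Rightarrow> 'a idx set \<Rightarrow> 'a idx set \<Rightarrow> 'a mat" where
  "skel_asc X Y Z = (\<lambda>t s.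
     if t \<in> skel_tenO X (skel_tenO Y Z) \<and> s \<in> skel_tenO (skel_tenO X Y) Z then
       (case (t, s) of
          (Node x (Node y z f \<mu>) d \<nu>, Node (Node x' y' e \<alpha>) z' d' \<beta>) \<Rightarrow>
            if x = x' \<and> y = y' \<and> z = z' \<and> d = d'
            then Fsym S (rlabel x) (rlabel y) (rlabel z) d (e, \<alpha>, \<beta>) (f, \<mu>, \<nu>) else 0
        | _ \<Rightarrow> 0)
     else 0)"

definition skel_lun :: "'a idx set \<Rightarrow> 'a mat" where
  "skel_lun X = (\<lambda>t s. if t \<in> X \<and> s = Node (Leaf (unit_label S) 0) t (rlabel t) 0 then 1 else 0)"

definition skel_run :: "'a idx set \<Rightarrow> 'a mat" where
  "skel_run X = (\<lambda>t s. if t \<in> X \<and> s = Node t (Leaf (unit_label S) 0) (rlabel t) 0 then 1 else 0)"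

text \<open>
  The left evaluation of a simple object is the basis vector of \<open>V\<^bsub>a*a\<^esub>\<^bsup>1\<^esup>\<close>, the right one is
  \<open>eps a\<close> times the basis vector of \<open>V\<^bsub>aa*\<^esub>\<^bsup>1\<^esup>\<close>.  The zigzag identities then force the
  coefficients of the coevaluations, which are entries of \<open>F\<^bsup>a,a*,a\<^esup>\<^bsub>a\<^esub>\<close> and \<open>F\<^bsup>a*,a,a*\<^esup>\<^bsub>a*\<^esub>\<close>.
\<close>

definition F00 :: "'a \<Rightarrow> complex" where
  "F00 a = Fsym S a (dual_label S a) a a (unit_label S, 0, 0) (unit_label S, 0, 0)"

definition skel_ev :: "'a idx set \<Rightarrow> 'a mat" where
  "skel_ev X = (\<lambda>t s. if t = Leaf (unit_label S) 0 \<and> (\<exists>x\<in>X. s = Node (Dua x) x (unit_label S) 0)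
     then 1 else 0)"

definition skel_coev :: "'a idx set \<Rightarrow> 'a mat" where
  "skel_coev X = (\<lambda>t s. \<Sum>x\<in>X. if s = Leaf (unit_label S) 0 \<and> t = Node x (Dua x) (unit_label S) 0
     then 1 / F00 (rlabel x) else 0)"

definition skel_evr :: "'a idx set \<Rightarrow> 'a mat" where
  "skel_evr X = (\<lambda>t s. \<Sum>x\<in>X. if t = Leaf (unit_label S) 0 \<and> s = Node x (Dua x) (unit_label S) 0
     then eps S (rlabel x) else 0)"

definition skel_coevr :: "'a idx set \<Rightarrow> 'a mat" where
  "skel_coevr X = (\<lambda>t s. \<Sum>x\<in>X. if s = Leaf (unit_label S) 0 \<and> t = Node (Dua x) x (unit_label S) 0
     then eps S (rlabel x) / F00 (dual_label S (rlabel x)) else 0)"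

definition skeletal_category :: "('a idx set, 'a mat) pivcat" where
  "skeletal_category =
     \<lparr> obj = {X. finite X \<and> rlabel ` X \<subseteq> labels S},
       hom = skel_hom,
       ide = (\<lambda>X t s. if t = s \<and> s \<in> X then 1 else 0),
       cmp = skel_cmp,
       zer = (\<lambda>X Y t s. 0),
       add = (\<lambda>f g t s. f t s + g t s),
       scl = (\<lambda>z f t s. z * f t s),
       tenO = skel_tenO,
       tenM = skel_tenM,
       unit = skel_unit,
       asc = skel_asc,
       lun = skel_lun,
       run = skel_run,
       dl = (\<lambda>X. Dua ` X),
       ev = skel_ev,
       coev = skel_coev,
       evr = skel_evr,
       coevr = skel_coevr \<rparr>"

definition spherical_fusion_data :: bool where
  "spherical_fusion_data \<longleftrightarrow> finite (labels S) \<and> unit_label S \<in> labels S \<and>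
     (\<forall>a\<in>labels S. dual_label S a \<in> labels S) \<and> (\<forall>a\<in>labels S. eps S a \<in> {1, -1}) \<and>
     spherical_fusion_category skeletal_category"

definition F_entries :: "complex set" where
  "F_entries = {Fsym S a b c d (e, \<alpha>, \<beta>) (f, \<mu>, \<nu>) | a b c d e f \<alpha> \<beta> \<mu> \<nu>.
     {a, b, c, d, e, f} \<subseteq> labels S \<and> \<alpha> < Nrk S a b e \<and> \<beta> < Nrk S e c d \<and>
     \<mu> < Nrk S b c f \<and> \<nu> < Nrk S a f d}"

definition K_fusion :: "complex set" where
  "K_fusion = galois_closure (rat_adjoin F_entries)"

end

text \<open>Only the entries with admissible indices (those in \<open>F_entries\<close>, \<open>R_entries\<close>) matter; at other
  arguments the conjugated functions below carry no information.\<close>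

definition conj_fusion :: "(complex \<Rightarrow> complex) \<Rightarrow> 'a fusion_data \<Rightarrow> 'a fusion_data" where
  "conj_fusion q S = S \<lparr> Fsym := (\<lambda>a b c d i j. q (Fsym S a b c d i j)) \<rparr>"

definition skel_braid :: "'a modular_data \<Rightarrow> 'a idx set \<Rightarrow> 'a idx set \<Rightarrow> 'a mat" where
  "skel_braid M X Y = (\<lambda>t s.
     if t \<in> skel_tenO M Y X \<and> s \<in> skel_tenO M X Y then
       (case (t, s) of
          (Node y x c \<nu>, Node x' y' c' \<mu>) \<Rightarrow>
            if x = x' \<and> y = y' \<and> c = c' then Rsym M (rlabel M x) (rlabel M y) c \<mu> \<nu> else 0
        | _ \<Rightarrow> 0)
     else 0)"

definition skeletal_ribbon_category :: "'a modular_data \<Rightarrow> ('a idx set, 'a mat) ribcat" where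
  "skeletal_ribbon_category M =
     moncat.extend (moncat.truncate (skeletal_category M))
       (ribcat.fields (skel_braid M)
          (\<lambda>X. right_partial_trace (skeletal_category M) X (skel_braid M X X)))"

definition modular_category_data :: "'a modular_data \<Rightarrow> bool" where
  "modular_category_data M \<longleftrightarrow>
     spherical_fusion_data M \<and> modular_tensor_category (skeletal_ribbon_category M)"

definition R_entries :: "'a modular_data \<Rightarrow> complex set" where
  "R_entries M = {Rsym M a b c \<mu> \<nu> | a b c \<mu> \<nu>.
     {a, b, c} \<subseteq> labels M \<and> \<mu> < Nrk M a b c \<and> \<nu> < Nrk M b a c}"

definition K_modular :: "'a modular_data \<Rightarrow> complex set" where
  "K_modular M = galois_closure (rat_adjoin (F_entries M \<union> R_entries M))"

definition conj_modular :: "(complex \<Rightarrow> complex) \<Rightarrow> 'a modular_data \<Rightarrow> 'a modular_data" where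
  "conj_modular q M = M \<lparr> Fsym := (\<lambda>a b c d i j. q (Fsym M a b c d i j)),
                           Rsym := (\<lambda>a b c \<mu> \<nu>. q (Rsym M a b c \<mu> \<nu>)) \<rparr>"

end

theory Submission
  imports Defs "HOL-Computational_Algebra.Fundamental_Theorem_Algebra"
begin

text \<open>
  Extend \<open>q\<close> to an automorphism \<open>\<sigma>\<close> of the field of complex numbers and restrict \<open>\<sigma>\<close> to the other
  Galois closure, which it preserves.  Applying \<open>\<sigma>\<close> to all matrix entries is a \<open>\<sigma>\<close>-semilinear strict
  isomorphism from the category described by \<open>F\<close> (and \<open>R\<close>) to the one described by \<open>\<sigma>(F)\<close>
  (and \<open>\<sigma>(R)\<close>), and it carries half-braidings to half-braidings, hence induces one of Drinfeld
  centers.  Conjugating the given equivalence of the center with the modular category by these two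
  semilinear isomorphisms gives a functor that is linear again.
\<close>

section \<open>Extending field automorphisms to the complex numbers\<close>

text \<open>The extension to all of \<complex> answers an obstacle: half-braidings are arbitrary
  complex matrices, and nothing places the matrix entries of the given equivalence in a number
  field, so \<open>q\<close> itself cannot be applied to them. The extension comes from Zorn's lemma
  and is far from unique; for the data, only its values on the two Galois closures count. The number
  field hypotheses make the other closure stable, because an algebraic element can only go to a root
  of the same rational polynomial.

  A second obstacle lies in the encoding. At inadmissible indices \<open>Fsym\<close> and
  \<open>Rsym\<close> are arbitrary, and there \<open>q\<close> and \<sigma> may disagree. It has to
  be checked that every coefficient of the skeletal categories, those of the coevaluations included,
  is an admissible entry. Moreover, no category axioms are at hand for the conjugated data; what is
  used about that side is carried over along the entrywise bijection of matrices.\<close>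

text \<open>A field isomorphism between subfields of \<open>\<complex>\<close> is encoded by its graph, a subfield of the ring
  \<open>\<complex> \<times> \<complex>\<close>; the encoding is symmetric under \<open>converse\<close>.\<close>

definition field_graph :: "(complex \<times> complex) set \<Rightarrow> bool" where
  "field_graph G \<longleftrightarrow> (1, 1) \<in> G \<and>
     (\<forall>x y x' y'. (x, y) \<in> G \<longrightarrow> (x', y') \<in> G \<longrightarrow> (x - x', y - y') \<in> G \<and> (x / x', y / y') \<in> G) \<and>
     (\<forall>x y. (x, y) \<in> G \<longrightarrow> x = 0 \<longleftrightarrow> y = 0)"

definition poly_graph :: "(complex \<times> complex) set \<Rightarrow> (complex poly \<times> complex poly) set" where
  "poly_graph G = {(P, Q). \<forall>i. (coeff P i, coeff Q i) \<in> G}"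

text \<open>Meant as the extension by \<open>x\<close> \<mapsto> \<open>y\<close>. Fractions, and
  not just polynomials, are taken in order to cover transcendental \<open>x\<close>. That the result
  is again a function is the business of the matching condition in
  \<open>field_graph_adjoin\<close>.\<close>

definition graph_adjoin :: "(complex \<times> complex) set \<Rightarrow> complex \<Rightarrow> complex \<Rightarrow> (complex \<times> complex) set" where
  "graph_adjoin G x y = {(poly P x / poly P' x, poly Q y / poly Q' y) | P Q P' Q'.
     (P, Q) \<in> poly_graph G \<and> (P', Q') \<in> poly_graph G \<and> poly P' x \<noteq> 0 \<and> poly Q' y \<noteq> 0}"

section \<open>Arithmetic and long division along the graph of a field isomorphism\<close>

context
  fixes G assumes G: "field_graph G"
begin

lemma field_graph_one: "(1, 1) \<in> G"
  and field_graph_diff: "(x, y) \<in> G \<Longrightarrow> (x', y') \<in> G \<Longrightarrow> (x - x', y - y') \<in> G"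
  and field_graph_divide: "(x, y) \<in> G \<Longrightarrow> (x', y') \<in> G \<Longrightarrow> (x / x', y / y') \<in> G"
  and field_graph_eq_0: "(x, y) \<in> G \<Longrightarrow> x = 0 \<longleftrightarrow> y = 0"
  using G unfolding field_graph_def by blast+

lemma field_graph_zero: "(0, 0) \<in> G"
  using field_graph_diff[OF field_graph_one field_graph_one] by simp

lemma field_graph_add: "(x, y) \<in> G \<Longrightarrow> (x', y') \<in> G \<Longrightarrow> (x + x', y + y') \<in> G"
  using field_graph_diff[of x y "0 - x'" "0 - y'"] field_graph_diff[OF field_graph_zero, of x' y']
  by simp

lemma field_graph_mult: "(x, y) \<in> G \<Longrightarrow> (x', y') \<in> G \<Longrightarrow> (x * x', y * y') \<in> G"
  using field_graph_divide[of x y "1 / x'" "1 / y'"] field_graph_divide[OF field_graph_one, of x' y']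
  by simp

lemma field_graph_sum:
  "(\<And>i. i \<in> I \<Longrightarrow> (f i, g i) \<in> G) \<Longrightarrow> (sum f I, sum g I) \<in> G"
  by (induction I rule: infinite_finite_induct) (auto intro: field_graph_zero field_graph_add)

text \<open>The zero clause of \<open>field_graph\<close>, applied to a difference of two pairs,
  yields single-valuedness here and injectivity in the next lemma.\<close>

lemma field_graph_functional: "(x, y) \<in> G \<Longrightarrow> (x, y') \<in> G \<Longrightarrow> y = y'"
  using field_graph_diff[of x y x y'] field_graph_eq_0[of "x - x" "y - y'"] by simp

lemma field_graph_injective: "(x, y) \<in> G \<Longrightarrow> (x', y) \<in> G \<Longrightarrow> x = x'"
  using field_graph_diff[of x y x' y] field_graph_eq_0[of "x - x'" "y - y"] by simp

lemma poly_graph_zero: "(0, 0) \<in> poly_graph G"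
  by (simp add: poly_graph_def field_graph_zero)

lemma poly_graph_const: "(x, y) \<in> G \<Longrightarrow> ([:x:], [:y:]) \<in> poly_graph G"
  by (auto simp: poly_graph_def coeff_pCons field_graph_zero split: nat.split)

lemma poly_graph_monom: "(x, y) \<in> G \<Longrightarrow> (monom x n, monom y n) \<in> poly_graph G"
  by (simp add: poly_graph_def field_graph_zero)

lemma poly_graph_add:
  "(P, Q) \<in> poly_graph G \<Longrightarrow> (P', Q') \<in> poly_graph G \<Longrightarrow> (P + P', Q + Q') \<in> poly_graph G"
  by (simp add: poly_graph_def field_graph_add)

lemma poly_graph_diff:
  "(P, Q) \<in> poly_graph G \<Longrightarrow> (P', Q') \<in> poly_graph G \<Longrightarrow> (P - P', Q - Q') \<in> poly_graph G"
  by (simp add: poly_graph_def field_graph_diff)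

lemma poly_graph_mult:
  "(P, Q) \<in> poly_graph G \<Longrightarrow> (P', Q') \<in> poly_graph G \<Longrightarrow> (P * P', Q * Q') \<in> poly_graph G"
  by (simp add: poly_graph_def coeff_mult field_graph_sum field_graph_mult)

lemma poly_graph_eq_0: "(P, Q) \<in> poly_graph G \<Longrightarrow> P = 0 \<longleftrightarrow> Q = 0"
  using field_graph_eq_0 by (auto simp: poly_graph_def poly_eq_iff)

lemma poly_graph_degree: "(P, Q) \<in> poly_graph G \<Longrightarrow> degree P = degree Q"
proof -
  assume "(P, Q) \<in> poly_graph G"
  then have "coeff P i = 0 \<longleftrightarrow> coeff Q i = 0" for i
    using field_graph_eq_0 by (simp add: poly_graph_def)
  then show ?thesis
    by (simp add: degree_def)
qed

text \<open>One long division runs on both sides at once: corresponding polynomials have equal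
  degrees, and the quotients of their leading coefficients correspond again.\<close>

lemma poly_graph_division:
  assumes "(P, Q) \<in> poly_graph G" "P \<noteq> 0" "(A, B) \<in> poly_graph G"
  shows "\<exists>D E R S. (D, E) \<in> poly_graph G \<and> (R, S) \<in> poly_graph G \<and>
           A = P * D + R \<and> B = Q * E + S \<and> (R = 0 \<or> degree R < degree P)"
  using assms(3)
proof (induction "degree A" arbitrary: A B rule: less_induct)
  case less
  show ?case
  proof (cases "A = 0 \<or> degree A < degree P")
    case True
    show ?thesis
      by (rule exI[of _ 0], rule exI[of _ 0], rule exI[of _ A], rule exI[of _ B])
        (use True less.prems poly_graph_zero in auto)
  next
    case False
    define n where "n = degree A - degree P"
    define T where "T = monom (lead_coeff A / lead_coeff P) n"
    define U where "U = monom (lead_coeff B / lead_coeff Q) n"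
    have TU: "(T, U) \<in> poly_graph G"
      unfolding T_def U_def using less.prems assms(1) poly_graph_degree
      by (intro poly_graph_monom field_graph_divide) (auto simp: poly_graph_def)
    have AB: "(A - P * T, B - Q * U) \<in> poly_graph G"
      by (intro poly_graph_diff poly_graph_mult TU less.prems assms(1))
    have degT: "degree T \<le> n"
      unfolding T_def by (rule degree_monom_le)
    have n: "degree A = degree P + n"
      using False by (simp add: n_def)
    have "degree (A - P * T) \<le> degree A"
      using degree_mult_le[of P T] degT n by (intro degree_diff_le) auto
    moreover have "coeff (A - P * T) (degree A) = 0"
      using assms(2) by (simp add: T_def n mult.commute[of P] coeff_monom_mult)
    ultimately have "A - P * T = 0 \<or> degree (A - P * T) < degree A"
      by (rule eq_zero_or_degree_less)
    then have "\<exists>D E R S. (D, E) \<in> poly_graph G \<and> (R, S) \<in> poly_graph G \<and>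
       A - P * T = P * D + R \<and> B - Q * U = Q * E + S \<and> (R = 0 \<or> degree R < degree P)"
    proof
      \<comment> \<open>Treated apart because the induction gets no smaller degree when
        \<open>A\<close> is a nonzero constant: the difference 0 also has degree 0.\<close>
      assume "A - P * T = 0"
      then show ?thesis
        using AB poly_graph_zero poly_graph_eq_0 by force
    next
      assume "degree (A - P * T) < degree A"
      from less.hyps[OF this AB] show ?thesis .
    qed
    then obtain D E R S where *: "(D, E) \<in> poly_graph G" "(R, S) \<in> poly_graph G"
       "A - P * T = P * D + R" "B - Q * U = Q * E + S" "R = 0 \<or> degree R < degree P"
      by blast
    show ?thesis
      by (rule exI[of _ "D + T"], rule exI[of _ "E + U"], rule exI[of _ R], rule exI[of _ S])
        (use * in \<open>auto simp: algebra_simps intro: poly_graph_add TU\<close>)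
  qed
qed

lemma graph_adjoin_superset: "G \<subseteq> graph_adjoin G x y"
proof clarify
  fix a b assume "(a, b) \<in> G"
  then show "(a, b) \<in> graph_adjoin G x y"
    unfolding graph_adjoin_def
    by (intro CollectI exI[of _ "[:a:]"] exI[of _ "[:b:]"] exI[of _ "[:1:]"])
      (simp add: poly_graph_const field_graph_one del: one_poly_eq_simps)
qed

lemma graph_adjoin_self: "(x, y) \<in> graph_adjoin G x y"
  unfolding graph_adjoin_def
  by (intro CollectI exI[of _ "monom 1 1"] exI[of _ "[:1:]"])
    (simp add: poly_graph_const poly_graph_monom field_graph_one poly_monom del: one_poly_eq_simps)

text \<open>The matching condition covers both ways to extend: \<open>x\<close> and \<open>y\<close> transcendental, or roots of
  corresponding minimal polynomials.\<close>

lemma field_graph_adjoin: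
  assumes match: "\<And>P Q. (P, Q) \<in> poly_graph G \<Longrightarrow> poly P x = 0 \<longleftrightarrow> poly Q y = 0"
  shows "field_graph (graph_adjoin G x y)"
  unfolding field_graph_def
proof (intro conjI allI impI)
  show "(1, 1) \<in> graph_adjoin G x y"
    using graph_adjoin_superset field_graph_one by blast
next
  fix a b assume "(a, b) \<in> graph_adjoin G x y"
  then show "a = 0 \<longleftrightarrow> b = 0"
    using match by (auto simp: graph_adjoin_def)
next
  fix a b a' b' assume "(a, b) \<in> graph_adjoin G x y" "(a', b') \<in> graph_adjoin G x y"
  then obtain P Q R S P' Q' R' S' where *:
    "(P, Q) \<in> poly_graph G" "(R, S) \<in> poly_graph G" "poly R x \<noteq> 0" "poly S y \<noteq> 0"
    "(P', Q') \<in> poly_graph G" "(R', S') \<in> poly_graph G" "poly R' x \<noteq> 0" "poly S' y \<noteq> 0"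
    and ab: "a = poly P x / poly R x" "b = poly Q y / poly S y"
      "a' = poly P' x / poly R' x" "b' = poly Q' y / poly S' y"
    unfolding graph_adjoin_def by blast
  show "(a - a', b - b') \<in> graph_adjoin G x y"
    unfolding graph_adjoin_def
    by (intro CollectI exI[of _ "P * R' - P' * R"] exI[of _ "Q * S' - Q' * S"] exI[of _ "R * R'"]
        exI[of _ "S * S'"])
      (use * in \<open>auto simp: ab field_simps intro!: poly_graph_diff poly_graph_mult\<close>)
  show "(a / a', b / b') \<in> graph_adjoin G x y"
  \<comment> \<open>By the match the divisor vanishes on both sides or on neither; if it vanishes,
    both quotients are 0 by the convention for division.\<close>
  proof (cases "poly P' x = 0")
    case True
    then have "poly Q' y = 0"
      using match *(5) by blast
    with True show ?thesis
      using graph_adjoin_superset field_graph_zero by (auto simp: ab)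
  next
    case False
    then have "poly Q' y \<noteq> 0"
      using match *(5) by blast
    with False show ?thesis
      unfolding graph_adjoin_def
      by (intro CollectI exI[of _ "P * R'"] exI[of _ "Q * S'"] exI[of _ "R * P'"] exI[of _ "S * Q'"])
        (use * in \<open>auto simp: ab field_simps intro!: poly_graph_mult\<close>)
  qed
qed

text \<open>By minimality \<open>P\<close> divides every \<open>A\<close> that vanishes at
  \<open>x\<close>. The division carries over to the other side, so \<open>Q\<close> divides
  \<open>B\<close>.\<close>

lemma poly_graph_minimal_root:
  assumes "(P, Q) \<in> poly_graph G" "P \<noteq> 0" "poly P x = 0" "poly Q y = 0"
    and min: "\<And>A B. (A, B) \<in> poly_graph G \<Longrightarrow> A \<noteq> 0 \<Longrightarrow> poly A x = 0 \<Longrightarrow> degree P \<le> degree A"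
    and "(A, B) \<in> poly_graph G" "poly A x = 0"
  shows "poly B y = 0"
proof -
  obtain D E R S where *: "(D, E) \<in> poly_graph G" "(R, S) \<in> poly_graph G"
       "A = P * D + R" "B = Q * E + S" "R = 0 \<or> degree R < degree P"
    using poly_graph_division[OF assms(1,2,6)] by blast
  have "poly R x = 0"
    using * assms by simp
  then have "R = 0"
    using * min[of R S] by fastforce
  then show ?thesis
    using * poly_graph_eq_0[of R S] assms by simp
qed

end

section \<open>Extending a field isomorphism to algebraic elements and to the complex
  numbers\<close>

lemma field_graph_converse: "field_graph G \<Longrightarrow> field_graph (G\<inverse>)"
  unfolding field_graph_def by auto

lemma poly_graph_converse: "(Q, P) \<in> poly_graph (G\<inverse>) \<longleftrightarrow> (P, Q) \<in> poly_graph G"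
  by (simp add: poly_graph_def)

text \<open>With \<open>Domain G = Range G\<close> this shows that a polynomial is the left member
  of some corresponding pair iff it is the right member of one.\<close>

lemma poly_graph_partner:
  assumes "field_graph G"
  shows "(\<exists>Q. (P, Q) \<in> poly_graph G) \<longleftrightarrow> (\<forall>i. coeff P i \<in> Domain G)"
proof
  assume "\<forall>i. coeff P i \<in> Domain G"
  define g where "g = (\<lambda>x. SOME y. (x, y) \<in> G)"
  have g: "(x, g x) \<in> G" if "x \<in> Domain G" for x
    using that unfolding g_def by (metis Domain.cases someI_ex)
  have "g 0 = 0"
    using g field_graph_eq_0[OF assms] field_graph_zero[OF assms] by blast
  then have "(P, map_poly g P) \<in> poly_graph G"
    using g \<open>\<forall>i. coeff P i \<in> Domain G\<close> by (simp add: poly_graph_def coeff_map_poly)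
  then show "\<exists>Q. (P, Q) \<in> poly_graph G" ..
qed (auto simp: poly_graph_def)

lemma degree_pos_of_root:
  fixes P :: "complex poly"
  assumes "P \<noteq> 0" "poly P x = 0"
  shows "degree P > 0"
proof (rule ccontr)
  assume "\<not> degree P > 0"
  then obtain c where "P = [:c:]"
    by (auto elim: degree_eq_zeroE)
  with assms show False by simp
qed

text \<open>The element \<open>x\<close> goes to any root \<open>y\<close> of the image
  \<open>Q\<close> of its minimal polynomial \<open>P\<close>. Matching from \<open>x\<close> to
  \<open>y\<close> uses the minimality of \<open>P\<close>; the way back needs that \<open>Q\<close>
  has least degree for \<open>y\<close>. The range is not controlled: surjectivity will come from
  applying the lemma to the converse graph.\<close>

lemma field_graph_extend_algebraic:
  assumes G: "field_graph G" and PQ: "(P, Q) \<in> poly_graph G" "P \<noteq> 0" "poly P x = 0"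
  shows "\<exists>H. field_graph H \<and> G \<subseteq> H \<and> x \<in> Domain H"
proof -
  let ?rt = "\<lambda>P. \<exists>Q. (P, Q) \<in> poly_graph G \<and> P \<noteq> 0 \<and> poly P x = 0"
  have "\<exists>P. ?rt P" using PQ by blast
  then obtain P where "?rt P" and min: "\<And>A. ?rt A \<Longrightarrow> degree P \<le> degree A"
    using ex_has_least_nat[of ?rt _ degree] by metis
  then obtain Q where PQ: "(P, Q) \<in> poly_graph G" "P \<noteq> 0" "poly P x = 0"
    by blast
  have deg: "degree P = degree Q" and "Q \<noteq> 0"
    using poly_graph_degree[OF G PQ(1)] poly_graph_eq_0[OF G PQ(1)] PQ(2) by auto
  have "degree P > 0"
    using degree_pos_of_root PQ(2,3) by blast
  then obtain y where y: "poly Q y = 0"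
    using fundamental_theorem_of_algebra[of Q] constant_degree[of Q] deg by auto
  have "poly A x = 0 \<longleftrightarrow> poly B y = 0" if AB: "(A, B) \<in> poly_graph G" for A B
  proof
    assume "poly A x = 0"
    then show "poly B y = 0"
      using poly_graph_minimal_root[OF G PQ y _ AB] min by blast
  next
    assume B: "poly B y = 0"
    have "degree Q \<le> degree B'" if B': "(B', A') \<in> poly_graph (G\<inverse>)" "B' \<noteq> 0" "poly B' y = 0" for A' B'
    proof -
      \<comment> \<open>Divide \<open>Q\<close> by a polynomial of minimal degree vanishing at \<open>y\<close>; the quotient
        of \<open>P\<close> is too small to vanish at \<open>x\<close>.\<close>
      let ?rt' = "\<lambda>B. \<exists>A. (A, B) \<in> poly_graph G \<and> B \<noteq> 0 \<and> poly B y = 0"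
      have "?rt' B'" using B' poly_graph_converse by blast
      then obtain B1 where "?rt' B1" and min': "\<And>A. ?rt' A \<Longrightarrow> degree B1 \<le> degree A"
        using ex_has_least_nat[of ?rt' _ degree] by metis
      then obtain A1 where A1: "(A1, B1) \<in> poly_graph G" "B1 \<noteq> 0" "poly B1 y = 0"
        by blast
      then have deg1: "degree A1 = degree B1" and "A1 \<noteq> 0"
        using poly_graph_degree[OF G A1(1)] poly_graph_eq_0[OF G A1(1)] by auto
      have "degree B1 > 0"
        using degree_pos_of_root A1(2,3) by blast
      obtain D E R S where *: "(D, E) \<in> poly_graph G" "(R, S) \<in> poly_graph G"
        "P = A1 * D + R" "Q = B1 * E + S" "R = 0 \<or> degree R < degree A1"
        using poly_graph_division[OF G A1(1) \<open>A1 \<noteq> 0\<close> PQ(1)] by blast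
      have "poly S y = 0" using * A1 y by simp
      have "S = 0"
      proof (rule ccontr)
        assume "S \<noteq> 0"
        then have "degree B1 \<le> degree S"
          using min'[of S] *(2) \<open>poly S y = 0\<close> by blast
        moreover have "degree R < degree A1" 
          using * \<open>S \<noteq> 0\<close> poly_graph_eq_0[OF G *(2)] by blast
        ultimately show False
          using poly_graph_degree[OF G *(2)] deg1 by simp
      qed
      then have P: "P = A1 * D" using * poly_graph_eq_0[OF G *(2)] by simp
      with PQ \<open>A1 \<noteq> 0\<close> have "D \<noteq> 0" by auto
      then have degP: "degree P = degree A1 + degree D"
        using P \<open>A1 \<noteq> 0\<close> by (simp add: degree_mult_eq)
      have "poly D x \<noteq> 0"
        using min[of D] *(1) \<open>D \<noteq> 0\<close> degP deg1 \<open>degree B1 > 0\<close> by fastforce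
      then have "poly A1 x = 0" using P PQ by simp
      then have "degree P \<le> degree A1"
        using min[of A1] A1(1) \<open>A1 \<noteq> 0\<close> by blast
      then have "degree P \<le> degree B1" using deg1 by simp
      also have "\<dots> \<le> degree B'" using min'[OF \<open>?rt' B'\<close>] .
      finally show ?thesis using deg by simp
    qed
    then show "poly A x = 0"
      using poly_graph_minimal_root[OF field_graph_converse[OF G], of Q P y x B A]
        PQ y B AB \<open>Q \<noteq> 0\<close> poly_graph_converse by blast
  qed
  then show ?thesis
    using field_graph_adjoin[OF G] graph_adjoin_superset[OF G] graph_adjoin_self[OF G] by blast
qed

lemma field_graph_Union:
  assumes "\<C> \<noteq> {}" "\<And>G. G \<in> \<C> \<Longrightarrow> field_graph G"
    and chain: "\<And>G H. G \<in> \<C> \<Longrightarrow> H \<in> \<C> \<Longrightarrow> G \<subseteq> H \<or> H \<subseteq> G"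
  shows "field_graph (\<Union>\<C>)"
  unfolding field_graph_def
proof (intro conjI allI impI)
  show "(1, 1) \<in> \<Union>\<C>"
    using assms field_graph_one by blast
next
  fix a b assume "(a, b) \<in> \<Union>\<C>"
  then show "a = 0 \<longleftrightarrow> b = 0"
    using assms(2) field_graph_eq_0 by blast
next
  fix a b a' b' assume "(a, b) \<in> \<Union>\<C>" "(a', b') \<in> \<Union>\<C>"
  then obtain G where "G \<in> \<C>" "(a, b) \<in> G" "(a', b') \<in> G"
    using chain by blast
  then show "(a - a', b - b') \<in> \<Union>\<C>" "(a / a', b / b') \<in> \<Union>\<C>"
    using assms(2) field_graph_diff field_graph_divide by blast+
qed

text \<open>The side condition \<open>Q\<close> lets one application of Zorn's lemma serve twice:
  for graphs with equal domain and range, and for all graphs.\<close>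

lemma field_graph_maximal:
  assumes "field_graph G" "Q G"
    and Q: "\<And>\<C>. \<C> \<noteq> {} \<Longrightarrow> (\<And>H. H \<in> \<C> \<Longrightarrow> Q H) \<Longrightarrow> Q (\<Union>\<C>)"
  shows "\<exists>M. field_graph M \<and> Q M \<and> G \<subseteq> M \<and> (\<forall>H. field_graph H \<longrightarrow> Q H \<longrightarrow> M \<subseteq> H \<longrightarrow> H = M)"
proof -
  let ?A = "{H. field_graph H \<and> Q H \<and> G \<subseteq> H}"
  have "\<exists>M\<in>?A. \<forall>H\<in>?A. M \<subseteq> H \<longrightarrow> H = M"
  proof (rule subset_Zorn_nonempty)
    show "?A \<noteq> {}" using assms by blast
  next
    fix \<C> assume "\<C> \<noteq> {}" and chain: "subset.chain ?A \<C>"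
    have "\<C> \<subseteq> ?A" and "\<And>G H. G \<in> \<C> \<Longrightarrow> H \<in> \<C> \<Longrightarrow> G \<subseteq> H \<or> H \<subseteq> G"
      using chain by (auto simp: subset_chain_def)
    then show "\<Union>\<C> \<in> ?A"
      using \<open>\<C> \<noteq> {}\<close> field_graph_Union[of \<C>] Q[of \<C>] by blast
  qed
  then show ?thesis
    by (smt (verit) mem_Collect_eq subset_trans)
qed

definition complex_automorphism :: "(complex \<Rightarrow> complex) \<Rightarrow> bool" where
  "complex_automorphism \<sigma> \<longleftrightarrow> bij \<sigma> \<and> \<sigma> 1 = 1 \<and>
     (\<forall>x y. \<sigma> (x + y) = \<sigma> x + \<sigma> y) \<and> (\<forall>x y. \<sigma> (x * y) = \<sigma> x * \<sigma> y)"

lemma field_graph_extends_to_automorphism: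
  assumes "field_graph G" "Domain G = Range G"
  shows "\<exists>\<sigma>. complex_automorphism \<sigma> \<and> (\<forall>(x, y)\<in>G. \<sigma> x = y)"
proof -
  \<comment> \<open>A maximal automorphism (not merely isomorphism) of a subfield exhausts the transcendental elements,
    since it extends by \<open>x \<mapsto> x\<close>; this replaces a transcendence basis and makes the final
    extension surjective.\<close>
  obtain M where M: "field_graph M" "Domain M = Range M" "G \<subseteq> M"
    and maxM: "\<And>H. field_graph H \<Longrightarrow> Domain H = Range H \<Longrightarrow> M \<subseteq> H \<Longrightarrow> H = M"
    using field_graph_maximal[of G "\<lambda>G. Domain G = Range G"] assms by (smt (verit) Domain_Union Range_Union Sup.SUP_cong)
  have M_poly: "(\<exists>Q. (P, Q) \<in> poly_graph M) \<longleftrightarrow> (\<exists>Q. (Q, P) \<in> poly_graph M)" for P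
    using poly_graph_partner[OF M(1)] poly_graph_partner[OF field_graph_converse[OF M(1)]] M(2)
    by (simp add: poly_graph_converse)
  have algebraic: "\<exists>P Q. (P, Q) \<in> poly_graph M \<and> P \<noteq> 0 \<and> poly P x = 0" for x
  proof (rule ccontr)
    assume no: "\<not> ?thesis"
    \<comment> \<open>Domain and range of \<open>M\<close> are the same field, so \<open>x\<close>
      is transcendental over it on both sides, and corresponding polynomials vanish at
      \<open>x\<close> only if both are 0.\<close>
    have match: "poly P x = 0 \<longleftrightarrow> poly Q x = 0" if "(P, Q) \<in> poly_graph M" for P Q
      using no that M_poly poly_graph_eq_0[OF M(1) that] by (metis poly_0)
    let ?H = "graph_adjoin M x x"
    have "Domain ?H = Range ?H"
    proof (intro set_eqI iffI)
      fix z assume "z \<in> Domain ?H"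
      then obtain P P' Q Q' where "(P, Q) \<in> poly_graph M" "(P', Q') \<in> poly_graph M"
        "poly P' x \<noteq> 0" "z = poly P x / poly P' x"
        unfolding graph_adjoin_def by blast
      moreover obtain R R' where "(R, P) \<in> poly_graph M" "(R', P') \<in> poly_graph M"
        using calculation(1,2) M_poly by meson
      ultimately show "z \<in> Range ?H"
        using match unfolding graph_adjoin_def by blast
    next
      fix z assume "z \<in> Range ?H"
      then obtain P P' Q Q' where "(P, Q) \<in> poly_graph M" "(P', Q') \<in> poly_graph M"
        "poly Q' x \<noteq> 0" "z = poly Q x / poly Q' x"
        unfolding graph_adjoin_def by blast
      moreover obtain R R' where "(Q, R) \<in> poly_graph M" "(Q', R') \<in> poly_graph M"
        using calculation(1,2) M_poly by meson
      ultimately show "z \<in> Domain ?H"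
        using match unfolding graph_adjoin_def by blast
    qed
    then have "?H = M"
      using maxM field_graph_adjoin[OF M(1) match] graph_adjoin_superset[OF M(1)] by blast
    then have "(x, x) \<in> M"
      using graph_adjoin_self[OF M(1)] by blast
    \<comment> \<open>Now \<open>x\<close> lies in the domain, so the polynomial X - x has its
      coefficients there and makes \<open>x\<close> algebraic.\<close>
    then have "(monom 1 1 - [:x:], monom 1 1 - [:x:]) \<in> poly_graph M"
      by (intro poly_graph_diff poly_graph_monom poly_graph_const field_graph_one M)
    moreover have "poly (monom 1 1 - [:x:]) x = 0"
      by (simp add: poly_monom)
    moreover have "coeff (monom 1 1 - [:x:]) 1 \<noteq> coeff 0 1"
      by simp
    then have "monom 1 1 - [:x:] \<noteq> 0"
      by metis
    ultimately show False
      using no by blast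
  qed
  \<comment> \<open>The second maximal graph drops the condition on domain and range: an algebraic
    \<open>x\<close> may go to any conjugate, so its extension need not keep the two fields
    equal.\<close>
  obtain N where N: "field_graph N" "M \<subseteq> N" 
    and maxN: "\<And>H. field_graph H \<Longrightarrow> N \<subseteq> H \<Longrightarrow> H = N"
    using field_graph_maximal[OF M(1), of "\<lambda>_. True", OF TrueI TrueI] by metis
  have mono: "poly_graph M \<subseteq> poly_graph N" using N by (auto simp: poly_graph_def)
  have "x \<in> Domain N" for x
    using field_graph_extend_algebraic[OF N(1)] algebraic[of x] mono maxN by blast
  \<comment> \<open>\<open>x\<close> is also algebraic over the range of \<open>M\<close>, so the
    converse of \<open>N\<close> would extend to \<open>x\<close>; maximality of \<open>N\<close>
    forbids a proper extension.\<close>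
  moreover have "x \<in> Range N" for x
  proof -
    obtain P Q where "(P, Q) \<in> poly_graph M" "P \<noteq> 0" "poly P x = 0"
      using algebraic by blast
    then obtain Q where "(Q, P) \<in> poly_graph N"
      using M_poly mono by blast
    then obtain H where H: "field_graph H" "N\<inverse> \<subseteq> H" "x \<in> Domain H"
      using field_graph_extend_algebraic[OF field_graph_converse[OF N(1)], of P Q x] \<open>P \<noteq> 0\<close> \<open>poly P x = 0\<close>
        poly_graph_converse by blast
    then have "N \<subseteq> H\<inverse>" by auto
    then have "H\<inverse> = N" using maxN[OF field_graph_converse[OF H(1)]] by blast
    then show ?thesis using H by blast
  qed
  ultimately have "\<forall>x. \<exists>y. (x, y) \<in> N" "\<forall>y. \<exists>x. (x, y) \<in> N"
    by (simp_all add: Domain_iff Range_iff)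
  then obtain \<sigma> \<tau> where st: "\<And>x. (x, \<sigma> x) \<in> N" "\<And>y. (\<tau> y, y) \<in> N"
    by metis
  have \<sigma>: "\<sigma> x = y" if "(x, y) \<in> N" for x y
    using field_graph_functional[OF N(1) st(1) that] .
  have "\<sigma> (\<tau> y) = y" "\<tau> (\<sigma> x) = x" for x y
    using st \<sigma> field_graph_injective[OF N(1)] by blast+
  then have "bij \<sigma>" by (metis bijI')
  then have "complex_automorphism \<sigma>"
    using field_graph_one[OF N(1)] field_graph_add[OF N(1)] field_graph_mult[OF N(1)] \<sigma> st
    by (auto simp: complex_automorphism_def)
  then show ?thesis using \<sigma> M N by blast
qed

section \<open>Automorphisms of the complex numbers and roots of rational polynomials\<close>

context
  fixes \<sigma> assumes \<sigma>: "complex_automorphism \<sigma>"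
begin

lemma complex_automorphism_bij: "bij \<sigma>"
  and complex_automorphism_1: "\<sigma> 1 = 1"
  and complex_automorphism_add: "\<sigma> (x + y) = \<sigma> x + \<sigma> y"
  and complex_automorphism_mult: "\<sigma> (x * y) = \<sigma> x * \<sigma> y"
  using \<sigma> by (simp_all add: complex_automorphism_def)

lemma complex_automorphism_eq_iff: "\<sigma> x = \<sigma> y \<longleftrightarrow> x = y"
  using complex_automorphism_bij by (simp add: bij_is_inj inj_eq)

lemma complex_automorphism_0: "\<sigma> 0 = 0"
  using complex_automorphism_add[of 0 0] by simp

lemma complex_automorphism_eq_0: "\<sigma> x = 0 \<longleftrightarrow> x = 0"
  using complex_automorphism_eq_iff[of x 0] complex_automorphism_0 by simp

lemma complex_automorphism_minus: "\<sigma> (- x) = - \<sigma> x"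
  using complex_automorphism_add[of x "- x"] complex_automorphism_0 by (simp add: minus_unique)

lemma complex_automorphism_inverse: "\<sigma> (inverse x) = inverse (\<sigma> x)"
proof (cases "x = 0")
  case False
  then have "\<sigma> x * \<sigma> (inverse x) = 1"
    using complex_automorphism_mult[of x "inverse x"] complex_automorphism_1 by simp
  then show ?thesis
    by (metis inverse_unique)
qed (simp add: complex_automorphism_0)

lemma complex_automorphism_divide: "\<sigma> (x / y) = \<sigma> x / \<sigma> y"
  by (simp add: divide_inverse complex_automorphism_mult complex_automorphism_inverse)

lemma complex_automorphism_sum: "\<sigma> (sum f I) = (\<Sum>i\<in>I. \<sigma> (f i))"
  by (induction I rule: infinite_finite_induct)
    (simp_all add: complex_automorphism_0 complex_automorphism_add)

lemma complex_automorphism_of_nat: "\<sigma> (of_nat n) = of_nat n"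
  by (induction n) (simp_all add: complex_automorphism_0 complex_automorphism_1 complex_automorphism_add)

lemma complex_automorphism_of_rat: "\<sigma> (of_rat r) = of_rat r"
proof (cases r)
  case (Fract a b)
  have "\<sigma> (of_int i) = of_int i" for i
    by (cases i) (simp_all add: complex_automorphism_of_nat complex_automorphism_minus
        complex_automorphism_add complex_automorphism_1 del: of_nat_Suc)
  with Fract show ?thesis
    by (simp add: of_rat_rat complex_automorphism_divide)
qed

lemma complex_automorphism_poly:
  "poly (map_poly of_rat p) (\<sigma> x) = \<sigma> (poly (map_poly of_rat p) x)"
  by (induction p)
    (simp_all add: map_poly_pCons complex_automorphism_0 complex_automorphism_add
      complex_automorphism_mult complex_automorphism_of_rat)

lemma complex_automorphism_root:
  "poly (map_poly of_rat p) (\<sigma> x) = 0 \<longleftrightarrow> poly (map_poly of_rat p) x = 0"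
  by (simp add: complex_automorphism_poly complex_automorphism_eq_0)

lemma complex_automorphism_inv: "complex_automorphism (inv \<sigma>)"
proof -
  have *: "inv \<sigma> (\<sigma> x) = x" "\<sigma> (inv \<sigma> x) = x" for x
    using complex_automorphism_bij by (simp_all add: bij_is_inj bij_is_surj surj_f_inv_f)
  show ?thesis
    unfolding complex_automorphism_def
    using complex_automorphism_bij
    by (metis * bij_imp_bij_inv complex_automorphism_1 complex_automorphism_add
        complex_automorphism_mult)
qed

text \<open>The Galois closure is an intersection of normal fields, so its stability is reduced to
  stability of that family under preimages. Rational polynomials enter because \<sigma> maps their
  roots to roots.\<close>

lemma normal_over_rat_vimage:
  assumes "normal_over_rat N"
  shows "normal_over_rat (\<sigma> -` N)"
  unfolding normal_over_rat_def
proof (intro conjI allI impI)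
  show "complex_subfield (\<sigma> -` N)"
    using assms
    by (simp add: normal_over_rat_def complex_subfield_def complex_automorphism_0
        complex_automorphism_1 complex_automorphism_add complex_automorphism_mult
        complex_automorphism_minus complex_automorphism_inverse)
next
  fix p :: "rat poly" and z :: complex
  assume "irreducible p" "\<exists>z\<in>\<sigma> -` N. poly (map_poly of_rat p) z = 0" "poly (map_poly of_rat p) z = 0"
  then show "z \<in> \<sigma> -` N"
    using assms complex_automorphism_root unfolding normal_over_rat_def by (metis vimage_eq)
qed

end

text \<open>The powers of \<open>x\<close> lie in a finite-dimensional rational space, and a linear
  relation between them is a polynomial with root \<open>x\<close>. One of least degree is
  irreducible, the form in which \<open>normal_over_rat\<close> can use it.\<close>

lemma number_field_root:
  assumes "number_field K" "x \<in> K"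
  shows "\<exists>p::rat poly. irreducible p \<and> poly (map_poly of_rat p) x = 0"
proof -
  interpret vector_space "\<lambda>(r::rat) (z::complex). of_rat r * z"
    by unfold_locales (simp_all add: algebra_simps of_rat_add of_rat_mult)
  have pow: "x ^ n \<in> K" for n
    using assms by (induction n) (auto simp: number_field_def complex_subfield_def)
  obtain B where B: "finite B" "K \<subseteq> span B"
  proof -
    obtain B where B: "finite B" "\<And>x. x \<in> K \<Longrightarrow> \<exists>r::complex \<Rightarrow> rat. x = (\<Sum>b\<in>B. of_rat (r b) * b)"
      using assms unfolding number_field_def by metis
    then have "K \<subseteq> span B"
      by (force intro: span_sum span_scale span_base)
    with B show ?thesis using that by blast
  qed
  have "\<exists>p::rat poly. p \<noteq> 0 \<and> poly (map_poly of_rat p) x = 0"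
  \<comment> \<open>\<open>dependent\<close> speaks of the set of powers and ignores repetitions:
    for \<open>x\<close> = 1 that set is independent. Coinciding powers give X^m - X^n
    directly.\<close>
  proof (cases "inj (\<lambda>n::nat. x ^ n)")
    case True
    have "dependent (range (\<lambda>n::nat. x ^ n))"
    proof (rule ccontr)
      assume "independent (range (\<lambda>n::nat. x ^ n))"
      then have "finite (range (\<lambda>n::nat. x ^ n))"
        using independent_span_bound[OF B(1)] B(2) pow by blast
      then show False
        using True finite_imageD by blast
    qed
    then obtain U u where U: "finite U" "U \<subseteq> range (\<lambda>n::nat. x ^ n)"
      "(\<Sum>v\<in>U. of_rat (u v) * v) = 0" "\<exists>v\<in>U. u v \<noteq> (0::rat)"
      unfolding dependent_explicit by blast
    obtain I where I: "U = (\<lambda>n::nat. x ^ n) ` I"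
      using U(2) by (meson subset_imageE)
    have inj: "inj_on (\<lambda>n::nat. x ^ n) I"
      using True inj_on_subset by blast
    then have "finite I"
      using U(1) I finite_imageD by blast
    define p where "p = (\<Sum>n\<in>I. monom (u (x ^ n)) n)"
    have coeff_p: "coeff p n = (if n \<in> I then u (x ^ n) else 0)" for n
      using \<open>finite I\<close> by (simp add: p_def coeff_sum if_distrib sum.delta cong: if_cong)
    have "p \<noteq> 0"
      using U(4) I coeff_p by (metis coeff_0 imageE)
    moreover have "poly (map_poly of_rat p) x = (\<Sum>n\<in>I. of_rat (u (x ^ n)) * x ^ n)"
    proof -
      have "map_poly of_rat p = (\<Sum>n\<in>I. monom (of_rat (u (x ^ n)) :: complex) n)"
        using \<open>finite I\<close>
        by (intro poly_eqI)
          (simp add: coeff_map_poly coeff_p coeff_sum if_distrib sum.delta cong: if_cong)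
      then show ?thesis
        by (simp add: poly_sum poly_monom)
    qed
    ultimately show ?thesis
      using U(3) I inj by (auto simp: sum.reindex)
  next
    case False
    then obtain m n where mn: "m \<noteq> n" "x ^ m = x ^ n"
      unfolding inj_def by blast
    define p :: "rat poly" where "p = monom 1 m - monom 1 n"
    have "coeff p m \<noteq> coeff 0 m"
      using mn by (simp add: p_def)
    then have "p \<noteq> 0" by metis
    moreover have "map_poly of_rat p = (monom 1 m - monom 1 n :: complex poly)"
      by (rule poly_eqI) (simp add: p_def coeff_map_poly of_rat_diff)
    then have "poly (map_poly of_rat p) x = 0"
      using mn by (simp add: poly_monom)
    ultimately show ?thesis by blast
  qed
  then obtain p :: "rat poly" where p: "p \<noteq> 0" "poly (map_poly of_rat p) x = 0"
    and min: "\<And>q. q \<noteq> 0 \<Longrightarrow> poly (map_poly of_rat q) x = 0 \<Longrightarrow> degree p \<le> degree q"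
    using ex_has_least_nat[of "\<lambda>p::rat poly. p \<noteq> 0 \<and> poly (map_poly of_rat p) x = 0" _ degree]
    by (metis (no_types, lifting))
  have mult: "map_poly of_rat (a * b) = map_poly of_rat a * (map_poly of_rat b :: complex poly)"
    for a b :: "rat poly"
    by (rule poly_eqI) (simp add: coeff_map_poly coeff_mult of_rat_sum of_rat_mult)
  have unit: "is_unit q" if "degree q = 0" "q \<noteq> 0" for q :: "rat poly"
    using that is_unit_iff_degree by blast
  have "irreducible p"
  proof (rule irreducibleI)
    show "p \<noteq> 0" by fact
    show "\<not> is_unit p"
    proof
      assume "is_unit p"
      then obtain c where "p = [:c:]" "c \<noteq> 0"
        using p(1) is_unit_iff_degree by (metis degree_eq_zeroE pCons_0_0)
      then show False
        using p(2) by (simp add: map_poly_pCons)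
    qed
    fix a b assume ab: "p = a * b"
    then have "poly (map_poly of_rat a) x = 0 \<or> poly (map_poly of_rat b) x = 0"
      using p(2) mult by simp
    moreover have "a \<noteq> 0" "b \<noteq> 0" "degree p = degree a + degree b"
      using ab p(1) by (auto simp: degree_mult_eq)
    ultimately show "is_unit a \<or> is_unit b"
      using min[of a] min[of b] unit by fastforce
  qed
  with p(2) show ?thesis by blast
qed

section \<open>Galois closures: stability, restriction and extension of automorphisms\<close>

lemma galois_closure_superset: "K \<subseteq> galois_closure K"
  by (auto simp: galois_closure_def)

lemma galois_closure_subfield: "complex_subfield (galois_closure K)"
  by (auto simp: galois_closure_def normal_over_rat_def complex_subfield_def)

lemma rat_adjoin_superset: "A \<subseteq> rat_adjoin A"
  by (auto simp: rat_adjoin_def)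

text \<open>If \<open>N\<close> is normal and contains \<open>K\<close>, so does its preimage under
  \<sigma>: an element of \<open>K\<close> is moved to another root of its irreducible polynomial,
  which normality puts into \<open>N\<close>. Hence the preimage contains the closure.\<close>

lemma galois_closure_automorphism:
  assumes "complex_automorphism \<sigma>" "number_field K"
  shows "\<sigma> ` galois_closure K \<subseteq> galois_closure K"
proof -
  have "\<sigma> x \<in> N" if N: "normal_over_rat N" "K \<subseteq> N" and x: "x \<in> galois_closure K" for x N
  proof -
    have "K \<subseteq> \<sigma> -` N"
    proof
      fix y assume "y \<in> K"
      then obtain p :: "rat poly" where "irreducible p" "poly (map_poly of_rat p) y = 0"
        using number_field_root assms(2) by blast
      then show "y \<in> \<sigma> -` N"
        using N \<open>y \<in> K\<close> complex_automorphism_root[OF assms(1)] unfolding normal_over_rat_def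
        by (metis subsetD vimageI2)
    qed
    then show ?thesis
      using normal_over_rat_vimage[OF assms(1) N(1)] x by (auto simp: galois_closure_def)
  qed
  then show ?thesis by (auto simp: galois_closure_def)
qed

lemma galois_group_restrict:
  assumes "complex_automorphism \<sigma>" "number_field K"
  shows "restrict \<sigma> (galois_closure K) \<in> galois_group (galois_closure K)"
proof -
  let ?L = "galois_closure K"
  have L: "complex_subfield ?L" by (rule galois_closure_subfield)
  have rat: "of_rat r \<in> ?L" for r
  proof -
    have "of_nat n \<in> ?L" for n
      using L by (induction n) (auto simp: complex_subfield_def)
    then have int: "of_int i \<in> ?L" for i
      using L by (cases i rule: int_cases2) (auto simp: complex_subfield_def)
    show ?thesis
      using L int by (cases r) (auto simp: of_rat_rat divide_inverse complex_subfield_def)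
  qed
  have "?L \<subseteq> \<sigma> ` ?L"
  proof
    fix x assume "x \<in> ?L"
    then have "inv \<sigma> x \<in> ?L"
      using galois_closure_automorphism[OF complex_automorphism_inv[OF assms(1)] assms(2)] by blast
    then show "x \<in> \<sigma> ` ?L"
      using complex_automorphism_bij[OF assms(1)] by (metis bij_inv_eq_iff imageI)
  qed
  then have "bij_betw \<sigma> ?L ?L"
    using galois_closure_automorphism[OF assms]
      inj_on_subset[OF bij_is_inj[OF complex_automorphism_bij[OF assms(1)]] subset_UNIV]
    by (simp add: bij_betw_def subset_antisym)
  then show ?thesis
    using L rat complex_automorphism_add[OF assms(1)] complex_automorphism_mult[OF assms(1)]
      complex_automorphism_of_rat[OF assms(1)]
    by (simp add: galois_group_def complex_subfield_def cong: bij_betw_cong)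
qed

text \<open>An element of the Galois group is bijective on \<open>K\<close>, so its graph has domain
  and range \<open>K\<close>, as \<open>field_graph_extends_to_automorphism\<close>
  requires.\<close>

lemma galois_group_extend:
  assumes "complex_subfield K" "q \<in> galois_group K"
  shows "\<exists>\<sigma>. complex_automorphism \<sigma> \<and> (\<forall>x\<in>K. \<sigma> x = q x)"
proof -
  have q: "q x \<in> K" "q (x + y) = q x + q y" "q (x * y) = q x * q y" "q (of_rat r) = of_rat r"
    if "x \<in> K" "y \<in> K" for x y r
    using assms(2) that by (auto simp: galois_group_def bij_betw_def)
  have K: "0 \<in> K" "1 \<in> K" "\<And>x. x \<in> K \<Longrightarrow> - x \<in> K" "\<And>x. x \<in> K \<Longrightarrow> inverse x \<in> K"
    "\<And>x y. x \<in> K \<Longrightarrow> y \<in> K \<Longrightarrow> x + y \<in> K" "\<And>x y. x \<in> K \<Longrightarrow> y \<in> K \<Longrightarrow> x * y \<in> K"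
    using assms(1) by (auto simp: complex_subfield_def)
  have q01: "q 0 = 0" "q 1 = 1"
    using q(4)[OF K(1,1), of 0] q(4)[OF K(1,1), of 1] by simp_all
  have inj: "inj_on q K" and img: "q ` K = K"
    using assms(2) by (auto simp: galois_group_def bij_betw_def)
  have minus: "q (- x) = - q x" if "x \<in> K" for x
    using q(2)[of x "- x"] that K q01 by (simp add: minus_unique)
  have inverse: "q (inverse x) = inverse (q x)" if "x \<in> K" for x
  proof (cases "x = 0")
    case False
    then have "q x * q (inverse x) = 1"
      using q(3)[of x "inverse x"] that K q01 by simp
    then show ?thesis by (metis inverse_unique)
  qed (simp add: q01)
  define G where "G = (\<lambda>x. (x, q x)) ` K"
  have G_iff: "(x, y) \<in> G \<longleftrightarrow> x \<in> K \<and> y = q x" for x y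
    by (auto simp: G_def)
  have "field_graph G"
    unfolding field_graph_def
  proof (intro conjI allI impI)
    show "(1, 1) \<in> G" using K q01 by (simp add: G_iff)
    fix x y assume xy: "(x, y) \<in> G"
    then show "x = 0 \<longleftrightarrow> y = 0"
      using inj K(1) q01 unfolding G_iff inj_on_def by metis
    fix x' y' assume xy': "(x', y') \<in> G"
    have "q (x + - x') = q x + q (- x')" "q (x * inverse x') = q x * q (inverse x')"
      using xy xy' K(3,4) by (auto simp: G_iff intro!: q(2,3) simp del: add_uminus_conv_diff)
    then show "(x - x', y - y') \<in> G" "(x / x', y / y') \<in> G"
      using xy xy' K(3,4) K(5)[of x "- x'"] K(6)[of x "inverse x'"] minus[of x'] inverse[of x']
      by (simp_all add: G_iff divide_inverse)
  qed
  moreover have "Domain G = Range G"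
    using img by (simp add: G_def Domain_fst Range_snd image_image)
  ultimately obtain \<sigma> where "complex_automorphism \<sigma>" "\<forall>(x, y)\<in>G. \<sigma> x = y"
    using field_graph_extends_to_automorphism by blast
  then have "\<forall>x\<in>K. \<sigma> x = q x" by (auto simp: G_def)
  with \<open>complex_automorphism \<sigma>\<close> show ?thesis by blast
qed

section \<open>Semilinear isomorphisms of categories and centers\<close>

text \<open>A strict monoidal isomorphism that is semilinear over \<open>\<sigma>\<close>.  The set \<open>U\<close> is there so that closure of
  \<open>obj A\<close> under tensor products (for the center: that the tensor product of half-braidings is a
  half-braiding) is never needed.\<close>

locale conj_ribbon =
  fixes \<sigma> :: "complex \<Rightarrow> complex" and U :: "'o set" and Po :: "'o \<Rightarrow> 'o" and \<Phi> :: "'m \<Rightarrow> 'm"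
    and A A' :: "('o, 'm) ribcat"
  assumes U_obj: "obj A \<subseteq> U"
    and U_tenO: "X \<in> U \<Longrightarrow> Y \<in> U \<Longrightarrow> tenO A X Y \<in> U"
    and U_unit: "unit A \<in> U"
    and Po_obj: "X \<in> obj A \<Longrightarrow> Po X \<in> obj A'"
    and Po_surj: "P \<in> obj A' \<Longrightarrow> \<exists>X\<in>obj A. Po X = P"
    and Po_tenO: "X \<in> U \<Longrightarrow> Y \<in> U \<Longrightarrow> Po (tenO A X Y) = tenO A' (Po X) (Po Y)"
    and Po_unit: "Po (unit A) = unit A'"
    and \<Phi>_hom: "X \<in> obj A \<Longrightarrow> Y \<in> obj A \<Longrightarrow> bij_betw \<Phi> (hom A X Y) (hom A' (Po X) (Po Y))"
    and \<Phi>_ide: "X \<in> obj A \<Longrightarrow> \<Phi> (ide A X) = ide A' (Po X)"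
    and \<Phi>_cmp: "\<Phi> (cmp A g f) = cmp A' (\<Phi> g) (\<Phi> f)"
    and \<Phi>_add: "\<Phi> (add A f g) = add A' (\<Phi> f) (\<Phi> g)"
    and \<Phi>_scl: "\<Phi> (scl A z f) = scl A' (\<sigma> z) (\<Phi> f)"
    and \<Phi>_tenM: "\<Phi> (tenM A f g) = tenM A' (\<Phi> f) (\<Phi> g)"
    and \<Phi>_asc: "X \<in> obj A \<Longrightarrow> Y \<in> obj A \<Longrightarrow> Z \<in> obj A \<Longrightarrow>
      \<Phi> (asc A X Y Z) = asc A' (Po X) (Po Y) (Po Z)"
    and \<Phi>_lun: "X \<in> obj A \<Longrightarrow> \<Phi> (lun A X) = lun A' (Po X)"
    and \<Phi>_run: "X \<in> obj A \<Longrightarrow> \<Phi> (run A X) = run A' (Po X)"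
    and \<Phi>_braid: "X \<in> obj A \<Longrightarrow> Y \<in> obj A \<Longrightarrow> \<Phi> (braid A X Y) = braid A' (Po X) (Po Y)"
    and \<Phi>_twist: "X \<in> obj A \<Longrightarrow> \<Phi> (twist A X) = twist A' (Po X)"

text \<open>The composite goes back along \<rho>, through \<open>E\<close>, and forward along
  \<sigma>; a scalar z comes out as \<sigma> (\<rho> z) = z. \<open>iso_B\<close> is assumed apart
  because \<open>\<Phi>_hom\<close> covers only objects, while the tensor products in the source of
  \<open>J\<close> are not known to be objects.\<close>

lemma ribbon_equivalence_conj:
  assumes E: "ribbon_equivalence A B Fo Fm J u"
    and A: "conj_ribbon \<rho> U Po \<Phi> A' A"
    and B: "conj_ribbon \<sigma> V (\<lambda>P. P) \<Psi> B B'"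
    and iso_B: "\<And>P Q f. iso B P Q f \<Longrightarrow> iso B' P Q (\<Psi> f)"
    and inverse: "\<And>z. \<sigma> (\<rho> z) = z"
  shows "ribbon_equivalence A' B' (\<lambda>X. Fo (Po X)) (\<lambda>X Y f. \<Psi> (Fm (Po X) (Po Y) (\<Phi> f)))
           (\<lambda>X Y. \<Psi> (J (Po X) (Po Y))) (\<Psi> u)"
proof -
  interpret E: ribbon_equivalence A B Fo Fm J u by fact
  interpret A: conj_ribbon \<rho> U Po \<Phi> A' A by fact
  interpret B: conj_ribbon \<sigma> V "\<lambda>P. P" \<Psi> B B' by fact
  note U = subsetD[OF A.U_obj] subsetD[OF B.U_obj] A.U_tenO B.U_tenO A.U_unit B.U_unit
  note obj = A.Po_obj E.Fo_obj
  have hom: "\<Phi> f \<in> hom A (Po X) (Po Y)" if "X \<in> obj A'" "Y \<in> obj A'" "f \<in> hom A' X Y" for X Y f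
    using A.\<Phi>_hom that by (metis bij_betwE)
  show ?thesis
  proof
    fix X assume "X \<in> obj A'" then show "Fo (Po X) \<in> obj B'"
      using obj B.Po_obj by simp
  next
    fix X Y assume XY: "X \<in> obj A'" "Y \<in> obj A'"
    show "bij_betw (\<lambda>f. \<Psi> (Fm (Po X) (Po Y) (\<Phi> f))) (hom A' X Y) (hom B' (Fo (Po X)) (Fo (Po Y)))"
      using bij_betw_trans[OF bij_betw_trans[OF A.\<Phi>_hom E.fully_faithful] B.\<Phi>_hom] XY obj
      by (simp add: comp_def)
  next
    fix P assume "P \<in> obj B'"
    then have "P \<in> obj B" using B.Po_surj by auto
    then obtain X f where "X \<in> obj A" "iso B (Fo X) P f"
      using E.ess_surj by blast
    moreover obtain X' where "X' \<in> obj A'" "Po X' = X"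
      using A.Po_surj calculation by blast
    ultimately show "\<exists>X\<in>obj A'. \<exists>f. iso B' (Fo (Po X)) P f"
      using iso_B by blast
  next
    fix X Y assume XY: "X \<in> obj A'" "Y \<in> obj A'"
    show "iso B' (tenO B' (Fo (Po X)) (Fo (Po Y))) (Fo (Po (tenO A' X Y))) (\<Psi> (J (Po X) (Po Y)))"
      using iso_B[OF E.J_iso[of "Po X" "Po Y"]] XY obj U
      by (simp add: A.Po_tenO B.Po_tenO)
  next
    show "iso B' (unit B') (Fo (Po (unit A'))) (\<Psi> u)"
      using iso_B[OF E.u_iso] by (simp add: A.Po_unit B.Po_unit)
  next
    fix X Y Z f g
    assume XYZ: "X \<in> obj A'" "Y \<in> obj A'" "Z \<in> obj A'" "f \<in> hom A' X Y" "g \<in> hom A' Y Z"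
    show "\<Psi> (Fm (Po X) (Po Z) (\<Phi> (cmp A' g f))) =
        cmp B' (\<Psi> (Fm (Po Y) (Po Z) (\<Phi> g))) (\<Psi> (Fm (Po X) (Po Y) (\<Phi> f)))"
      using E.Fm_cmp[of "Po X" "Po Y" "Po Z" "\<Phi> f" "\<Phi> g"] XYZ
      by (simp add: obj hom A.\<Phi>_cmp B.\<Phi>_cmp)
  next
    fix X Y f z assume XY: "X \<in> obj A'" "Y \<in> obj A'" "f \<in> hom A' X Y"
    show "\<Psi> (Fm (Po X) (Po Y) (\<Phi> (scl A' z f))) = scl B' z (\<Psi> (Fm (Po X) (Po Y) (\<Phi> f)))"
      using XY by (simp add: obj hom A.\<Phi>_scl E.Fm_scl B.\<Phi>_scl inverse)
  qed (simp_all add: U obj hom A.Po_tenO A.Po_unit B.Po_unit inverse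
      A.\<Phi>_ide A.\<Phi>_add A.\<Phi>_tenM A.\<Phi>_asc A.\<Phi>_lun A.\<Phi>_run A.\<Phi>_braid A.\<Phi>_twist
      E.Fm_ide E.Fm_add E.Fm_twist
      B.\<Phi>_ide[symmetric] B.\<Phi>_cmp[symmetric] B.\<Phi>_add[symmetric]
      B.\<Phi>_tenM[symmetric] B.\<Phi>_asc[symmetric] B.\<Phi>_lun[symmetric] B.\<Phi>_run[symmetric]
      B.\<Phi>_braid[symmetric] B.\<Phi>_twist[symmetric]
      E.J_natural E.J_asc E.J_lun E.J_run E.Fm_braid)
qed

text \<open>The inverses \<open>ascinv\<close> and \<open>minv\<close> are listed as separate assumptions to make the locale symmetric in
  \<open>C\<close> and \<open>D\<close> without assuming the category axioms for either.\<close>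

locale conj_pivotal =
  fixes \<sigma> :: "complex \<Rightarrow> complex" and \<Phi> :: "'m \<Rightarrow> 'm" and C D :: "('o, 'm) pivcat"
  assumes bij_\<Phi>: "bij \<Phi>" and bij_\<sigma>: "bij \<sigma>"
    and obj_eq: "obj D = obj C"
    and tenO_eq: "tenO D = tenO C"
    and unit_eq: "unit D = unit C"
    and dl_eq: "dl D = dl C"
    and tenO_obj: "X \<in> obj C \<Longrightarrow> Y \<in> obj C \<Longrightarrow> tenO C X Y \<in> obj C"
    and unit_obj: "unit C \<in> obj C"
    and dl_obj: "X \<in> obj C \<Longrightarrow> dl C X \<in> obj C"
    and hom_iff: "\<Phi> f \<in> hom D X Y \<longleftrightarrow> f \<in> hom C X Y"
    and ide: "ide D X = \<Phi> (ide C X)"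
    and cmp: "cmp D (\<Phi> g) (\<Phi> f) = \<Phi> (cmp C g f)"
    and add: "add D (\<Phi> f) (\<Phi> g) = \<Phi> (add C f g)"
    and scl: "scl D (\<sigma> z) (\<Phi> f) = \<Phi> (scl C z f)"
    and tenM: "tenM D (\<Phi> f) (\<Phi> g) = \<Phi> (tenM C f g)"
    and asc: "X \<in> obj C \<Longrightarrow> Y \<in> obj C \<Longrightarrow> Z \<in> obj C \<Longrightarrow> asc D X Y Z = \<Phi> (asc C X Y Z)"
    and ascinv: "X \<in> obj C \<Longrightarrow> Y \<in> obj C \<Longrightarrow> Z \<in> obj C \<Longrightarrow> ascinv D X Y Z = \<Phi> (ascinv C X Y Z)"
    and lun: "X \<in> obj C \<Longrightarrow> lun D X = \<Phi> (lun C X)"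
    and run: "X \<in> obj C \<Longrightarrow> run D X = \<Phi> (run C X)"
    and runinv: "X \<in> obj C \<Longrightarrow> minv D (tenO C X (unit C)) X (run D X) =
      \<Phi> (minv C (tenO C X (unit C)) X (run C X))"
    and coev: "X \<in> obj C \<Longrightarrow> coev D X = \<Phi> (coev C X)"
    and evr: "X \<in> obj C \<Longrightarrow> evr D X = \<Phi> (evr C X)"
begin

lemma \<Phi>_inv: "\<Phi> (inv \<Phi> f) = f" "inv \<Phi> (\<Phi> f) = f"
  and \<sigma>_inv: "\<sigma> (inv \<sigma> z) = z"
  using bij_\<Phi> bij_\<sigma> by (simp_all add: bij_is_surj surj_f_inv_f bij_is_inj)

lemma \<Phi>_eq_iff: "\<Phi> f = \<Phi> g \<longleftrightarrow> f = g"
  using bij_\<Phi> by (simp add: bij_is_inj inj_eq)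

lemma minv_run:
  "X \<in> obj C \<Longrightarrow> minv D (tenO C X (unit C)) X (\<Phi> (run C X)) =
     \<Phi> (minv C (tenO C X (unit C)) X (run C X))"
  using runinv run by simp

text \<open>Supplies the functor from the conjugated center back to the original one, and
  surjectivity on objects in \<open>conj_ribbon_center\<close>.\<close>

lemma symmetric: "conj_pivotal (inv \<sigma>) (inv \<Phi>) D C"
proof
  show "bij (inv \<Phi>)" "bij (inv \<sigma>)"
    using bij_\<Phi> bij_\<sigma> by (simp_all add: bij_imp_bij_inv)
  show "inv \<Phi> f \<in> hom C X Y \<longleftrightarrow> f \<in> hom D X Y" for f X Y
    using hom_iff[of "inv \<Phi> f"] by (simp add: \<Phi>_inv)
  show "cmp C (inv \<Phi> g) (inv \<Phi> f) = inv \<Phi> (cmp D g f)" for f g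
    using cmp[of "inv \<Phi> g" "inv \<Phi> f"] by (simp add: \<Phi>_inv)
  show "add C (inv \<Phi> f) (inv \<Phi> g) = inv \<Phi> (add D f g)" for f g
    using add[of "inv \<Phi> f" "inv \<Phi> g"] by (simp add: \<Phi>_inv)
  show "tenM C (inv \<Phi> f) (inv \<Phi> g) = inv \<Phi> (tenM D f g)" for f g
    using tenM[of "inv \<Phi> f" "inv \<Phi> g"] by (simp add: \<Phi>_inv)
  show "scl C (inv \<sigma> z) (inv \<Phi> f) = inv \<Phi> (scl D z f)" for z f
    using scl[of "inv \<sigma> z" "inv \<Phi> f"] by (simp add: \<Phi>_inv \<sigma>_inv)
qed (simp_all add: obj_eq tenO_eq unit_eq dl_eq tenO_obj unit_obj dl_obj ide asc ascinv lun run
    minv_run coev evr \<Phi>_inv)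

lemma iso_iff: "iso D X Y (\<Phi> f) \<longleftrightarrow> iso C X Y f"
proof -
  have "inverse_pair D X Y (\<Phi> f) (\<Phi> g) \<longleftrightarrow> inverse_pair C X Y f g" for g
    by (simp add: inverse_pair_def hom_iff cmp ide \<Phi>_eq_iff)
  then show ?thesis
    unfolding iso_def by (metis \<Phi>_inv(1))
qed

text \<open>Takes care of the twists: the center and the skeletal ribbon category both define theirs
  by this formula.\<close>

lemma right_partial_trace:
  "X \<in> obj C \<Longrightarrow> right_partial_trace D X (\<Phi> b) = \<Phi> (right_partial_trace C X b)"
  unfolding right_partial_trace_def
  by (simp add: tenO_eq unit_eq dl_eq dl_obj run minv_run ide evr coev asc ascinv
      tenM cmp)

text \<open>The restriction keeps half-braidings extensional, so that every object of the conjugated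
  center is literally equal to an image.\<close>

definition conj_center :: "'o \<times> ('o \<Rightarrow> 'm) \<Rightarrow> 'o \<times> ('o \<Rightarrow> 'm)" where
  "conj_center = (\<lambda>(X, \<beta>). (X, \<lambda>W\<in>obj C. \<Phi> (\<beta> W)))"

lemma half_braiding_conj:
  assumes "X \<in> obj C" "half_braiding C X \<beta>"
  shows "half_braiding D X (\<lambda>W\<in>obj C. \<Phi> (\<beta> W))"
  unfolding half_braiding_def
proof (intro conjI ballI)
  \<comment> \<open>Naturality is tested on an arbitrary morphism of \<open>D\<close>; it is the
    image of its preimage under \<Phi>.\<close>
  fix W V f assume "W \<in> obj D" "V \<in> obj D" "f \<in> hom D W V"
  then have WV: "W \<in> obj C" "V \<in> obj C" "inv \<Phi> f \<in> hom C W V"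
    using hom_iff[of "inv \<Phi> f"] by (simp_all add: obj_eq \<Phi>_inv)
  then have "cmp C (\<beta> V) (tenM C (ide C X) (inv \<Phi> f)) = cmp C (tenM C (inv \<Phi> f) (ide C X)) (\<beta> W)"
    using assms(2) by (simp add: half_braiding_def)
  then have "cmp D (\<Phi> (\<beta> V)) (tenM D (ide D X) (\<Phi> (inv \<Phi> f))) =
      cmp D (tenM D (\<Phi> (inv \<Phi> f)) (ide D X)) (\<Phi> (\<beta> W))"
    by (simp only: ide tenM cmp)
  with WV show "cmp D ((\<lambda>W\<in>obj C. \<Phi> (\<beta> W)) V) (tenM D (ide D X) f) =
      cmp D (tenM D f (ide D X)) ((\<lambda>W\<in>obj C. \<Phi> (\<beta> W)) W)"
    by (simp add: \<Phi>_inv)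
qed (use assms in \<open>auto simp: half_braiding_def obj_eq tenO_eq iso_iff tenO_obj asc ide tenM cmp \<Phi>_eq_iff\<close>)

lemma conj_center_obj:
  "X \<in> obj (drinfeld_center C) \<Longrightarrow> conj_center X \<in> obj (drinfeld_center D)"
  by (auto simp: drinfeld_center_def conj_center_def obj_eq half_braiding_conj)

lemma conj_center_hom:
  assumes "X \<in> obj (drinfeld_center C)" "Y \<in> obj (drinfeld_center C)"
  shows "\<Phi> f \<in> hom (drinfeld_center D) (conj_center X) (conj_center Y) \<longleftrightarrow>
         f \<in> hom (drinfeld_center C) X Y"
  using assms
  by (auto simp: drinfeld_center_def conj_center_def obj_eq hom_iff ide tenM cmp \<Phi>_eq_iff)

lemma conj_ribbon_center:
  "conj_ribbon \<sigma> (obj C \<times> UNIV) conj_center \<Phi> (drinfeld_center C) (drinfeld_center D)"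
proof
  interpret inverse: conj_pivotal "inv \<sigma>" "inv \<Phi>" D C
    by (rule symmetric)
  fix P assume P: "P \<in> obj (drinfeld_center D)"
  have "conj_center (inverse.conj_center P) = P"
    using P by (auto simp: drinfeld_center_def conj_center_def inverse.conj_center_def
        obj_eq half_braiding_def \<Phi>_inv fun_eq_iff extensional_def restrict_def)
  then show "\<exists>X\<in>obj (drinfeld_center C). conj_center X = P"
    using inverse.conj_center_obj[OF P] by blast
next
  fix X Y assume XY: "X \<in> obj (drinfeld_center C)" "Y \<in> obj (drinfeld_center C)"
  show "bij_betw \<Phi> (hom (drinfeld_center C) X Y)
          (hom (drinfeld_center D) (conj_center X) (conj_center Y))"
  proof (rule bij_betw_byWitness[where f' = "inv \<Phi>"])
    show "inv \<Phi> ` hom (drinfeld_center D) (conj_center X) (conj_center Y) \<subseteq> hom (drinfeld_center C) X Y"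
      using conj_center_hom[OF XY, of "inv \<Phi> _"] by (auto simp: \<Phi>_inv)
  qed (use conj_center_hom[OF XY] in \<open>auto simp: \<Phi>_inv\<close>)
next
  \<comment> \<open>The formula for the tensor product of half-braidings consists of associators,
    identities and their values, so it is preserved for arbitrary second components.\<close>
  fix X Y assume "X \<in> obj C \<times> (UNIV :: ('o \<Rightarrow> 'm) set)" "Y \<in> obj C \<times> (UNIV :: ('o \<Rightarrow> 'm) set)"
  then show "conj_center (tenO (drinfeld_center C) X Y) =
      tenO (drinfeld_center D) (conj_center X) (conj_center Y)"
    by (auto simp: drinfeld_center_def conj_center_def tenO_eq obj_eq asc ascinv ide tenM cmp
        intro!: restrict_ext)
next
  show "conj_center (unit (drinfeld_center C)) = unit (drinfeld_center D)"
    by (auto simp: drinfeld_center_def conj_center_def tenO_eq unit_eq obj_eq run minv_run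
        lun cmp intro!: restrict_ext)
qed (auto simp: drinfeld_center_def conj_center_def obj_eq tenO_obj unit_obj half_braiding_conj
      ide cmp add scl tenM asc lun run right_partial_trace)

end

section \<open>Galois conjugation of skeletal categories\<close>

text \<open>Only indices from \<open>F_entries\<close> are constrained, since there alone
  \<open>q\<close> and \<sigma> are known to agree. The scheme type covers fusion data and modular
  data alike.\<close>

definition conjugate_data ::
  "(complex \<Rightarrow> complex) \<Rightarrow> ('a, 'x) fusion_data_scheme \<Rightarrow> ('a, 'x) fusion_data_scheme \<Rightarrow> bool" where
  "conjugate_data \<sigma> S S' \<longleftrightarrow> labels S' = labels S \<and> unit_label S' = unit_label S \<and>
     dual_label S' = dual_label S \<and> Nrk S' = Nrk S \<and> eps S' = eps S \<and>
     (\<forall>a b c d e f \<alpha> \<beta> \<mu> \<nu>. {a, b, c, d, e, f} \<subseteq> labels S \<longrightarrow> \<alpha> < Nrk S a b e \<longrightarrow>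
        \<beta> < Nrk S e c d \<longrightarrow> \<mu> < Nrk S b c f \<longrightarrow> \<nu> < Nrk S a f d \<longrightarrow>
        Fsym S' a b c d (e, \<alpha>, \<beta>) (f, \<mu>, \<nu>) = \<sigma> (Fsym S a b c d (e, \<alpha>, \<beta>) (f, \<mu>, \<nu>)))"

definition conj_mat :: "(complex \<Rightarrow> complex) \<Rightarrow> 'a mat \<Rightarrow> 'a mat" where
  "conj_mat \<sigma> f = (\<lambda>t s. \<sigma> (f t s))"

lemma skeletal_category_simps:
  "obj (skeletal_category S) = {X. finite X \<and> rlabel S ` X \<subseteq> labels S}"
  "hom (skeletal_category S) = skel_hom S"
  "ide (skeletal_category S) = (\<lambda>X t s. if t = s \<and> s \<in> X then 1 else 0)"
  "cmp (skeletal_category S) = skel_cmp"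
  "zer (skeletal_category S) = (\<lambda>X Y t s. 0)"
  "add (skeletal_category S) = (\<lambda>f g t s. f t s + g t s)"
  "scl (skeletal_category S) = (\<lambda>z f t s. z * f t s)"
  "tenO (skeletal_category S) = skel_tenO S"
  "tenM (skeletal_category S) = skel_tenM S"
  "unit (skeletal_category S) = skel_unit S"
  "asc (skeletal_category S) = skel_asc S"
  "lun (skeletal_category S) = skel_lun S"
  "run (skeletal_category S) = skel_run S"
  "dl (skeletal_category S) = (\<lambda>X. Dua ` X)"
  "ev (skeletal_category S) = skel_ev S"
  "coev (skeletal_category S) = skel_coev S"
  "evr (skeletal_category S) = skel_evr S"
  by (simp_all add: skeletal_category_def)

lemma bij_conj_mat: "bij \<sigma> \<Longrightarrow> bij (conj_mat \<sigma>)"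
  by (rule o_bij[of "conj_mat (inv \<sigma>)"])
    (simp_all add: conj_mat_def fun_eq_iff bij_is_inj bij_is_surj surj_f_inv_f)

lemma (in linear_category) minv_eq:
  assumes "X \<in> obj C" "Y \<in> obj C" "inverse_pair C X Y f g"
  shows "minv C X Y f = g"
  unfolding minv_def
proof (rule the_equality)
  fix g' assume g': "inverse_pair C X Y f g'"
  have "cmp C g' (cmp C f g) = cmp C (cmp C g' f) g"
    using assms g' cmp_assoc[of Y X Y X g f g'] by (simp add: inverse_pair_def)
  then show "g' = g"
    using assms g' cmp_ide[of Y X g] cmp_ide[of Y X g'] by (simp add: inverse_pair_def)
qed (rule assms)

lemma skel_hom_source: "f \<in> skel_hom S X Y \<Longrightarrow> f t s \<noteq> 0 \<Longrightarrow> s \<in> X"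
  unfolding skel_hom_def by blast

text \<open>The unitors and evaluations have a nonzero entry at a \<open>Node\<close> with basis
  index 0. As they are morphisms, that node belongs to their source, so the fusion space is nonzero.
  This makes \<open>F00\<close> an admissible F symbol, hence conjugated correctly.\<close>

lemma spherical_data_admissible:
  assumes S: "spherical_fusion_data S" and a: "a \<in> labels S"
  shows "0 < Nrk S (unit_label S) a a" "0 < Nrk S a (unit_label S) a"
    "0 < Nrk S (dual_label S a) a (unit_label S)" "0 < Nrk S a (dual_label S a) (unit_label S)"
proof -
  interpret C: spherical_fusion_category "skeletal_category S"
    using S by (simp add: spherical_fusion_data_def)
  let ?X = "{Leaf a 0}" and ?one = "Leaf (unit_label S) 0"
  have X: "?X \<in> obj (skeletal_category S)"
    using a by (simp add: skeletal_category_simps)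
  have "skel_lun S ?X \<in> skel_hom S (skel_tenO S (skel_unit S) ?X) ?X"
    using C.lun_iso[OF X] by (auto simp: iso_def inverse_pair_def skeletal_category_simps)
  then have "Node ?one (Leaf a 0) a 0 \<in> skel_tenO S (skel_unit S) ?X"
    using skel_hom_source[of "skel_lun S ?X" S _ _ "Leaf a 0" "Node ?one (Leaf a 0) a 0"]
    by (simp add: skel_lun_def)
  then show "0 < Nrk S (unit_label S) a a"
    by (simp add: skel_tenO_def)
  have "skel_run S ?X \<in> skel_hom S (skel_tenO S ?X (skel_unit S)) ?X"
    using C.run_iso[OF X] by (auto simp: iso_def inverse_pair_def skeletal_category_simps)
  then have "Node (Leaf a 0) ?one a 0 \<in> skel_tenO S ?X (skel_unit S)"
    using skel_hom_source[of "skel_run S ?X" S _ _ "Leaf a 0" "Node (Leaf a 0) ?one a 0"]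
    by (simp add: skel_run_def)
  then show "0 < Nrk S a (unit_label S) a"
    by (simp add: skel_tenO_def)
  have "skel_ev S ?X \<in> skel_hom S (skel_tenO S (Dua ` ?X) ?X) (skel_unit S)"
    using C.left_dual[OF X] by (simp add: dual_pair_def skeletal_category_simps)
  then have "Node (Dua (Leaf a 0)) (Leaf a 0) (unit_label S) 0 \<in> skel_tenO S (Dua ` ?X) ?X"
    using skel_hom_source[of "skel_ev S ?X" S _ _ "?one" "Node (Dua (Leaf a 0)) (Leaf a 0) (unit_label S) 0"]
    by (simp add: skel_ev_def)
  then show "0 < Nrk S (dual_label S a) a (unit_label S)"
    by (simp add: skel_tenO_def)
  have "skel_evr S ?X \<in> skel_hom S (skel_tenO S ?X (Dua ` ?X)) (skel_unit S)"
    using C.right_dual[OF X] by (simp add: dual_pair_def skeletal_category_simps)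
  moreover have "eps S a \<noteq> 0"
    using S a by (auto simp: spherical_fusion_data_def)
  ultimately have "Node (Leaf a 0) (Dua (Leaf a 0)) (unit_label S) 0 \<in> skel_tenO S ?X (Dua ` ?X)"
    using skel_hom_source[of "skel_evr S ?X" S _ _ "?one" "Node (Leaf a 0) (Dua (Leaf a 0)) (unit_label S) 0"]
    by (simp add: skel_evr_def)
  then show "0 < Nrk S a (dual_label S a) (unit_label S)"
    by (simp add: skel_tenO_def)
qed

section \<open>Entrywise conjugation of a skeletal category\<close>

context
  fixes \<sigma> and S S' :: "('a, 'x) fusion_data_scheme"
  assumes \<sigma>: "complex_automorphism \<sigma>" and S': "conjugate_data \<sigma> S S'"
begin

lemma conjugate_data_simps:
  "labels S' = labels S" "unit_label S' = unit_label S" "dual_label S' = dual_label S"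
  "Nrk S' = Nrk S" "eps S' = eps S"
  using S' by (simp_all add: conjugate_data_def)

lemma conjugate_data_Fsym:
  "{a, b, c, d, e, f} \<subseteq> labels S \<Longrightarrow> \<alpha> < Nrk S a b e \<Longrightarrow> \<beta> < Nrk S e c d \<Longrightarrow> \<mu> < Nrk S b c f \<Longrightarrow>
   \<nu> < Nrk S a f d \<Longrightarrow> Fsym S' a b c d (e, \<alpha>, \<beta>) (f, \<mu>, \<nu>) = \<sigma> (Fsym S a b c d (e, \<alpha>, \<beta>) (f, \<mu>, \<nu>))"
  using S' unfolding conjugate_data_def by blast

lemma rlabel_conj: "rlabel S' = rlabel S"
proof
  show "rlabel S' t = rlabel S t" for t
    by (induction t) (simp_all add: conjugate_data_simps)
qed

lemma skel_hom_conj: "conj_mat \<sigma> f \<in> skel_hom S' X Y \<longleftrightarrow> f \<in> skel_hom S X Y"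
  by (simp add: skel_hom_def conj_mat_def rlabel_conj complex_automorphism_eq_0[OF \<sigma>])

lemma skel_cmp_conj: "skel_cmp (conj_mat \<sigma> g) (conj_mat \<sigma> f) = conj_mat \<sigma> (skel_cmp g f)"
  by (simp add: skel_cmp_def conj_mat_def complex_automorphism_eq_0[OF \<sigma>]
      complex_automorphism_sum[OF \<sigma>] complex_automorphism_mult[OF \<sigma>])

lemma skel_tenO_conj: "skel_tenO S' = skel_tenO S"
  by (simp add: skel_tenO_def fun_eq_iff rlabel_conj conjugate_data_simps)

lemma skel_tenM_conj: "skel_tenM S' (conj_mat \<sigma> f) (conj_mat \<sigma> g) = conj_mat \<sigma> (skel_tenM S f g)"
  by (auto simp: skel_tenM_def conj_mat_def fun_eq_iff rlabel_conj conjugate_data_simps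
      complex_automorphism_0[OF \<sigma>] complex_automorphism_mult[OF \<sigma>] split: idx.split)

lemma skel_asc_conj:
  assumes "rlabel S ` X \<subseteq> labels S" "rlabel S ` Y \<subseteq> labels S" "rlabel S ` Z \<subseteq> labels S"
  shows "skel_asc S' X Y Z = conj_mat \<sigma> (skel_asc S X Y Z)"
proof (intro ext)
  fix t s
  show "skel_asc S' X Y Z t s = conj_mat \<sigma> (skel_asc S X Y Z) t s"
  proof (cases "t \<in> skel_tenO S X (skel_tenO S Y Z) \<and> s \<in> skel_tenO S (skel_tenO S X Y) Z")
    case True
    then obtain x y z f \<mu> d \<nu> x' y' e \<alpha> z' d' \<beta> where
      "t = Node x (Node y z f \<mu>) d \<nu>" "s = Node (Node x' y' e \<alpha>) z' d' \<beta>"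
      unfolding skel_tenO_def by blast
    with True show ?thesis
      using assms conjugate_data_Fsym[of "rlabel S x" "rlabel S y" "rlabel S z" d e f \<alpha> \<beta> \<mu> \<nu>]
      by (auto simp: skel_asc_def conj_mat_def skel_tenO_conj rlabel_conj
          complex_automorphism_0[OF \<sigma>] skel_tenO_def image_subset_iff)
  qed (auto simp: skel_asc_def conj_mat_def skel_tenO_conj complex_automorphism_0[OF \<sigma>])
qed

lemma F00_conj:
  assumes "spherical_fusion_data S" "a \<in> labels S"
  shows "F00 S' a = \<sigma> (F00 S a)"
  unfolding F00_def conjugate_data_simps
  using assms spherical_data_admissible[OF assms]
  by (intro conjugate_data_Fsym) (auto simp: spherical_fusion_data_def)

lemma conj_pivotal_skeletal:
  assumes S: "spherical_fusion_data S"
  shows "conj_pivotal \<sigma> (conj_mat \<sigma>) (skeletal_category S) (skeletal_category S')"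
proof -
  let ?C = "skeletal_category S" and ?D = "skeletal_category S'" and ?\<Phi> = "conj_mat \<sigma>"
  note simps = skeletal_category_simps conjugate_data_simps rlabel_conj skel_tenO_conj
  note \<sigma>_simps = complex_automorphism_0[OF \<sigma>] complex_automorphism_1[OF \<sigma>]
    complex_automorphism_add[OF \<sigma>] complex_automorphism_mult[OF \<sigma>]
    complex_automorphism_minus[OF \<sigma>] complex_automorphism_divide[OF \<sigma>]
    complex_automorphism_sum[OF \<sigma>]
  interpret C: spherical_fusion_category ?C
    using S by (simp add: spherical_fusion_data_def)
  have bij: "bij ?\<Phi>"
    using bij_conj_mat complex_automorphism_bij[OF \<sigma>] by blast
  have obj: "obj ?D = obj ?C"
    by (simp add: simps)
  have ide: "ide ?D X = ?\<Phi> (ide ?C X)" for X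
    by (simp add: simps conj_mat_def \<sigma>_simps fun_eq_iff)
  have asc: "asc ?D X Y Z = ?\<Phi> (asc ?C X Y Z)" if "X \<in> obj ?C" "Y \<in> obj ?C" "Z \<in> obj ?C" for X Y Z
    using that by (simp add: skel_asc_conj skeletal_category_simps)
  have run: "run ?D X = ?\<Phi> (run ?C X)" for X
    by (simp add: simps skel_run_def conj_mat_def \<sigma>_simps fun_eq_iff)
  have lun: "lun ?D X = ?\<Phi> (lun ?C X)" for X
    by (simp add: simps skel_lun_def conj_mat_def \<sigma>_simps fun_eq_iff)
  have unit: "unit ?D = unit ?C"
    by (simp add: simps skel_unit_def)
  have minv: "minv ?D X Y (?\<Phi> f) = ?\<Phi> (minv ?C X Y f)"
    if XY: "X \<in> obj ?C" "Y \<in> obj ?C" and f: "iso ?C X Y f" for X Y f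
  proof -
    obtain g where g: "inverse_pair ?C X Y f g"
      using f by (auto simp: iso_def)
    have iff: "inverse_pair ?D X Y (?\<Phi> f) (?\<Phi> h) \<longleftrightarrow> inverse_pair ?C X Y f h" for h
      unfolding inverse_pair_def ide
      by (simp add: skeletal_category_simps skel_hom_conj skel_cmp_conj inj_eq[OF bij_is_inj[OF bij]])
    have "minv ?D X Y (?\<Phi> f) = ?\<Phi> g"
      unfolding minv_def
    proof (rule the_equality)
      show "inverse_pair ?D X Y (?\<Phi> f) (?\<Phi> g)"
        using g iff by simp
      fix g' assume "inverse_pair ?D X Y (?\<Phi> f) g'"
      then obtain h where "g' = ?\<Phi> h" "inverse_pair ?C X Y f h"
        using bij iff by (metis bij_is_surj surjD)
      then show "g' = ?\<Phi> g"
        using C.minv_eq[OF XY] g by metis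
    qed
    then show ?thesis
      using C.minv_eq[OF XY g] by simp
  qed
  show ?thesis
  proof
    show "X \<in> obj ?C \<Longrightarrow> Y \<in> obj ?C \<Longrightarrow> tenO ?C X Y \<in> obj ?C" for X Y
      by (rule C.tenO_obj)
    show "unit ?C \<in> obj ?C"
      by (rule C.unit_obj)
    show "X \<in> obj ?C \<Longrightarrow> dl ?C X \<in> obj ?C" for X
      using C.left_dual[of X] by (simp add: dual_pair_def)
    show "X \<in> obj ?C \<Longrightarrow> Y \<in> obj ?C \<Longrightarrow> Z \<in> obj ?C \<Longrightarrow> ascinv ?D X Y Z = ?\<Phi> (ascinv ?C X Y Z)"
      for X Y Z
      using minv[OF _ _ C.asc_iso[of X Y Z]] C.tenO_obj asc
      by (simp add: ascinv_def skel_tenO_conj skeletal_category_simps(8))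
    show "X \<in> obj ?C \<Longrightarrow> minv ?D (tenO ?C X (unit ?C)) X (run ?D X) =
        ?\<Phi> (minv ?C (tenO ?C X (unit ?C)) X (run ?C X))" for X
      using minv[OF _ _ C.run_iso[of X]] C.tenO_obj C.unit_obj run by simp
    show "coev ?D X = ?\<Phi> (coev ?C X)" if "X \<in> obj ?C" for X
    proof -
      have "F00 S' (rlabel S x) = \<sigma> (F00 S (rlabel S x))" if "x \<in> X" for x
        using F00_conj[OF S] that \<open>X \<in> obj ?C\<close> by (auto simp: skeletal_category_simps)
      then show ?thesis
        by (auto simp: simps skel_coev_def conj_mat_def \<sigma>_simps fun_eq_iff if_distrib[of \<sigma>]
            intro!: sum.cong)
    qed
    show "evr ?D X = ?\<Phi> (evr ?C X)" if "X \<in> obj ?C" for X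
    proof -
      \<comment> \<open>Conjugation leaves \<open>eps\<close> unchanged, in accordance with \<sigma>
        fixing the signs 1 and -1.\<close>
      have "\<sigma> (eps S (rlabel S x)) = eps S (rlabel S x)" if "x \<in> X" for x
      proof -
        have "rlabel S x \<in> labels S"
          using that \<open>X \<in> obj ?C\<close> by (auto simp: skeletal_category_simps)
        then have "eps S (rlabel S x) = 1 \<or> eps S (rlabel S x) = - 1"
          using S by (auto simp: spherical_fusion_data_def)
        then show ?thesis
          by (auto simp: \<sigma>_simps)
      qed
      then show ?thesis
        by (auto simp: simps skel_evr_def conj_mat_def \<sigma>_simps fun_eq_iff if_distrib[of \<sigma>]
            intro!: sum.cong)
    qed
  qed (use bij complex_automorphism_bij[OF \<sigma>] obj ide asc run lun unit in
      \<open>simp_all add: simps skel_hom_conj skel_cmp_conj skel_tenM_conj\<close>,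
      simp_all add: conj_mat_def \<sigma>_simps)
qed

end

section \<open>Conjugated F and R symbols and the resulting equivalence\<close>

lemma conjugate_data_conj_fusion:
  assumes "\<And>x. x \<in> F_entries S \<Longrightarrow> q x = \<sigma> x"
  shows "conjugate_data \<sigma> S (conj_fusion q S)"
  using assms unfolding conjugate_data_def conj_fusion_def F_entries_def by (simp, blast)

lemma conjugate_data_conj_modular:
  assumes "\<And>x. x \<in> F_entries M \<Longrightarrow> q x = \<sigma> x"
  shows "conjugate_data \<sigma> M (conj_modular q M)"
  using assms unfolding conjugate_data_def conj_modular_def F_entries_def by (simp, blast)

lemma skeletal_ribbon_category_simps:
  "obj (skeletal_ribbon_category M) = obj (skeletal_category M)"
  "hom (skeletal_ribbon_category M) = hom (skeletal_category M)"
  "ide (skeletal_ribbon_category M) = ide (skeletal_category M)"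
  "cmp (skeletal_ribbon_category M) = cmp (skeletal_category M)"
  "add (skeletal_ribbon_category M) = add (skeletal_category M)"
  "scl (skeletal_ribbon_category M) = scl (skeletal_category M)"
  "tenO (skeletal_ribbon_category M) = tenO (skeletal_category M)"
  "tenM (skeletal_ribbon_category M) = tenM (skeletal_category M)"
  "unit (skeletal_ribbon_category M) = unit (skeletal_category M)"
  "asc (skeletal_ribbon_category M) = asc (skeletal_category M)"
  "lun (skeletal_ribbon_category M) = lun (skeletal_category M)"
  "run (skeletal_ribbon_category M) = run (skeletal_category M)"
  "braid (skeletal_ribbon_category M) = skel_braid M"
  "twist (skeletal_ribbon_category M) =
     (\<lambda>X. right_partial_trace (skeletal_category M) X (skel_braid M X X))"
  by (simp_all add: skeletal_ribbon_category_def skeletal_category_def moncat.defs ribcat.defs)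

lemma skel_braid_conj:
  assumes \<sigma>: "complex_automorphism \<sigma>" and q: "\<And>x. x \<in> F_entries M \<union> R_entries M \<Longrightarrow> q x = \<sigma> x"
    and XY: "rlabel M ` X \<subseteq> labels M" "rlabel M ` Y \<subseteq> labels M"
  shows "skel_braid (conj_modular q M) X Y = conj_mat \<sigma> (skel_braid M X Y)"
proof (intro ext)
  fix t s
  have M': "conjugate_data \<sigma> M (conj_modular q M)"
    using q by (intro conjugate_data_conj_modular) auto
  note simps = skel_tenO_conj[OF \<sigma> M'] rlabel_conj[OF \<sigma> M']
  show "skel_braid (conj_modular q M) X Y t s = conj_mat \<sigma> (skel_braid M X Y) t s"
  proof (cases "t \<in> skel_tenO M Y X \<and> s \<in> skel_tenO M X Y")
    case True
    then obtain y x c \<nu> x' y' c' \<mu> where ts: "t = Node y x c \<nu>" "s = Node x' y' c' \<mu>"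
      unfolding skel_tenO_def by blast
    \<comment> \<open>For matching indices the R symbol is an admissible entry; otherwise the matrix
      entry is 0, which \<sigma> fixes.\<close>
    have "q (Rsym M (rlabel M x) (rlabel M y) c \<mu> \<nu>) = \<sigma> (Rsym M (rlabel M x) (rlabel M y) c \<mu> \<nu>)"
      if "x = x'" "y = y'" "c = c'"
    proof (rule q)
      show "Rsym M (rlabel M x) (rlabel M y) c \<mu> \<nu> \<in> F_entries M \<union> R_entries M"
        using True XY that unfolding ts R_entries_def skel_tenO_def by blast
    qed
    with True show ?thesis
      by (simp add: ts skel_braid_def conj_mat_def simps complex_automorphism_0[OF \<sigma>])
        (simp add: conj_modular_def)
  next
    case False
    then show ?thesis
      by (auto simp: skel_braid_def conj_mat_def simps complex_automorphism_0[OF \<sigma>])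
  qed
qed

lemma conj_ribbon_skeletal:
  assumes \<sigma>: "complex_automorphism \<sigma>" and q: "\<And>x. x \<in> F_entries M \<union> R_entries M \<Longrightarrow> q x = \<sigma> x"
    and M: "spherical_fusion_data M"
  shows "conj_ribbon \<sigma> (obj (skeletal_category M)) (\<lambda>X. X) (conj_mat \<sigma>)
           (skeletal_ribbon_category M) (skeletal_ribbon_category (conj_modular q M))"
proof -
  have M': "conjugate_data \<sigma> M (conj_modular q M)"
    using q by (intro conjugate_data_conj_modular) auto
  interpret conj_pivotal \<sigma> "conj_mat \<sigma>" "skeletal_category M" "skeletal_category (conj_modular q M)"
    by (rule conj_pivotal_skeletal[OF \<sigma> M' M])
  have braid: "skel_braid (conj_modular q M) X Y = conj_mat \<sigma> (skel_braid M X Y)"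
    if "X \<in> obj (skeletal_category M)" "Y \<in> obj (skeletal_category M)" for X Y
    using that by (intro skel_braid_conj[OF \<sigma> q]) (simp_all add: skeletal_category_simps(1))
  show ?thesis
  proof
    fix X Y assume "X \<in> obj (skeletal_ribbon_category M)" "Y \<in> obj (skeletal_ribbon_category M)"
    show "bij_betw (conj_mat \<sigma>) (hom (skeletal_ribbon_category M) X Y)
        (hom (skeletal_ribbon_category (conj_modular q M)) X Y)"
      by (rule bij_betw_byWitness[where f' = "inv (conj_mat \<sigma>)"])
        (auto simp: skeletal_ribbon_category_simps(2) \<Phi>_inv hom_iff
          hom_iff[of "inv (conj_mat \<sigma>) _", symmetric])
  qed (simp_all add: skeletal_ribbon_category_simps obj_eq tenO_eq unit_eq tenO_obj unit_obj
      ide cmp add scl tenM asc lun run braid right_partial_trace)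
qed

text \<open>\<open>q\<close> and \<open>q'\<close> are linked only through \<sigma>, each agreeing
  with it on the entries of its own data. This symmetric form serves both directions of the
  theorem.\<close>

lemma mtc_equivalent_conj:
  fixes S :: "'a fusion_data" and M :: "'b modular_data"
  assumes S: "spherical_fusion_data S" and M: "modular_category_data M"
    and E: "mtc_equivalent (drinfeld_center (skeletal_category S)) (skeletal_ribbon_category M)"
    and \<sigma>: "complex_automorphism \<sigma>"
    and q: "\<And>x. x \<in> F_entries S \<Longrightarrow> q x = \<sigma> x"
    and q': "\<And>x. x \<in> F_entries M \<union> R_entries M \<Longrightarrow> q' x = \<sigma> x"
  shows "mtc_equivalent (drinfeld_center (skeletal_category (conj_fusion q S)))
           (skeletal_ribbon_category (conj_modular q' M))"
proof -
  have M: "spherical_fusion_data M"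
    using M by (simp add: modular_category_data_def)
  have M': "conjugate_data \<sigma> M (conj_modular q' M)"
    using q' by (intro conjugate_data_conj_modular) auto
  interpret S: conj_pivotal \<sigma> "conj_mat \<sigma>" "skeletal_category S" "skeletal_category (conj_fusion q S)"
    by (rule conj_pivotal_skeletal[OF \<sigma> conjugate_data_conj_fusion[OF q] S])
  interpret M: conj_pivotal \<sigma> "conj_mat \<sigma>" "skeletal_category M" "skeletal_category (conj_modular q' M)"
    by (rule conj_pivotal_skeletal[OF \<sigma> M' M])
  have iso: "iso (skeletal_ribbon_category (conj_modular q' M)) P Q (conj_mat \<sigma> f)"
    if "iso (skeletal_ribbon_category M) P Q f" for P Q f
    using that M.iso_iff[of P Q f]
    by (simp add: iso_def inverse_pair_def skeletal_ribbon_category_simps)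
  obtain Fo Fm J u where "ribbon_equivalence (drinfeld_center (skeletal_category S))
      (skeletal_ribbon_category M) Fo Fm J u"
    using E by (auto simp: mtc_equivalent_def)
  \<comment> \<open>The first functor is the inverse one, semilinear over
    \<open>inv \<sigma>\<close>, so that the scalars cancel by
    \<open>S.\<sigma>_inv\<close>.\<close>
  from ribbon_equivalence_conj[OF this conj_pivotal.conj_ribbon_center[OF S.symmetric]
      conj_ribbon_skeletal[OF \<sigma> q' M] iso S.\<sigma>_inv]
  show ?thesis
    unfolding mtc_equivalent_def by blast
qed

theorem theorem3p4:
  fixes S :: "'a fusion_data" and M :: "'b modular_data"
  assumes "spherical_fusion_data S"
    and "number_field (rat_adjoin (F_entries S))"
    and "modular_category_data M"
    and "number_field (rat_adjoin (F_entries M \<union> R_entries M))"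
    and "mtc_equivalent (drinfeld_center (skeletal_category S)) (skeletal_ribbon_category M)"
  shows "(\<forall>q\<in>galois_group (K_fusion S). \<exists>q'\<in>galois_group (K_modular M).
            mtc_equivalent (drinfeld_center (skeletal_category (conj_fusion q S)))
              (skeletal_ribbon_category (conj_modular q' M))) \<and>
         (\<forall>q'\<in>galois_group (K_modular M). \<exists>q\<in>galois_group (K_fusion S).
            mtc_equivalent (drinfeld_center (skeletal_category (conj_fusion q S)))
              (skeletal_ribbon_category (conj_modular q' M)))"
proof -
  have sub: "F_entries S \<subseteq> K_fusion S" "F_entries M \<union> R_entries M \<subseteq> K_modular M"
    unfolding K_fusion_def K_modular_def
    by (rule order_trans[OF rat_adjoin_superset galois_closure_superset])+
  have equiv: "mtc_equivalent (drinfeld_center (skeletal_category (conj_fusion q S)))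
      (skeletal_ribbon_category (conj_modular q' M))"
    if "complex_automorphism \<sigma>" "\<And>x. x \<in> K_fusion S \<Longrightarrow> q x = \<sigma> x"
      "\<And>x. x \<in> K_modular M \<Longrightarrow> q' x = \<sigma> x" for \<sigma> q q'
    using mtc_equivalent_conj[OF assms(1,3,5) that(1)] that(2,3) sub by blast
  show ?thesis
  proof (intro conjI ballI)
    fix q assume "q \<in> galois_group (K_fusion S)"
    then obtain \<sigma> where \<sigma>: "complex_automorphism \<sigma>" "\<forall>x\<in>K_fusion S. \<sigma> x = q x"
      using galois_group_extend galois_closure_subfield unfolding K_fusion_def by blast
    show "\<exists>q'\<in>galois_group (K_modular M).
        mtc_equivalent (drinfeld_center (skeletal_category (conj_fusion q S)))
          (skeletal_ribbon_category (conj_modular q' M))"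
    proof
      show "restrict \<sigma> (K_modular M) \<in> galois_group (K_modular M)"
        unfolding K_modular_def by (rule galois_group_restrict[OF \<sigma>(1) assms(4)])
    qed (rule equiv[OF \<sigma>(1)], use \<sigma>(2) in simp_all)
  next
    fix q' assume "q' \<in> galois_group (K_modular M)"
    then obtain \<sigma> where \<sigma>: "complex_automorphism \<sigma>" "\<forall>x\<in>K_modular M. \<sigma> x = q' x"
      using galois_group_extend galois_closure_subfield unfolding K_modular_def by blast
    show "\<exists>q\<in>galois_group (K_fusion S).
        mtc_equivalent (drinfeld_center (skeletal_category (conj_fusion q S)))
          (skeletal_ribbon_category (conj_modular q' M))"
    proof
      show "restrict \<sigma> (K_fusion S) \<in> galois_group (K_fusion S)"
        unfolding K_fusion_def by (rule galois_group_restrict[OF \<sigma>(1) assms(2)])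
    qed (rule equiv[OF \<sigma>(1)], use \<sigma>(2) in simp_all)
  qed
qed

end
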